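(* Let $\boldsymbol{X}$ be a Poisson process with unknown intensity $s$ with respect to the Lebesgue measure on some interval $J$ of length $L$. Assume that $\sqrt{s}$ has finite $\alpha$-variation equal to $V$ on $J$, both $\alpha\in(0,1]$ and $V$ being unknown. One can build a T-estimator $\hat s(\boldsymbol{X})$ (not depending on $s$, $\alpha$ or $V$) such that, for $q\ge1$, $$\mathbb{E}_s\left[H^q(s,\hat s)\right]\le C(q)\left[\left(L^{1/2}V\right)\vee1\right]^{q/(2\alpha+1)},$$ where $C(q)$ depends on $q$ only.
   Context: $\lambda$ is Lebesgue measure on the interval $J\subset\mathbb{R}$ of finite length $L$, $\mathbb{L}_1^+(\lambda)$ the nonnegative elements of $\mathbb{L}_1(\lambda)$; $a\vee b=\max(a,b)$. A Poisson process with intensity $s\in\mathbb{L}_1^+(\lambda)$ is a point process $\boldsymbol{X}=\{X_1,\dots,X_N\}$ with $N$ Poisson with parameter $\int s\,d\lambda$ and, conditionally on $N$, the $X_i$ i.i.d. with density $s/\int s\,d\lambda$; $\mathbb{E}_s$ is the corresponding expectation. $\mathbb{P}_\mu$ refers to a Poisson process with finite mean measure $\mu$. For finite measures $H^2(\mu,\mu')=\frac12\int(\sqrt{d\mu/d\nu}-\sqrt{d\mu'/d\nu})^2d\nu$ ($\nu$ any dominating measure); $\mu_t=t\cdot\lambda$, $H(t,u)=H(\mu_t,\mu_u)=2^{-1/2}\|\sqrt t-\sqrt u\|_2$, with $\|\cdot\|_2$ the norm of $\mathbb{L}_2(\lambda)$. The $\alpha$-variation $V_\alpha(f;J)$ of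 $f$ on $J$, $\alpha\in(0,1]$, is defined by $[V_\alpha(f;J)]^{1/\alpha}=\sup_{i\ge1}\sup_{x_0<\cdots<x_i,\,x_j\in J}\sum_{j=1}^i|f(x_j)-f(x_{j-1})|^{1/\alpha}$. T-estimators. A subset $S'$ of a metric space $(M,d)$ is a D-model with parameters $\eta,D,B'>0$ if $|S'\cap\mathcal{B}(t,x\eta)|\le B'\exp[Dx^2]$ for all $x\ge2$, $t\in M$ (open balls). Take a countable family of D-models $S_m$ in $(\mathbb{L}_1^+(\lambda),H)$ with parameters $\eta_m,D_m,B'$ such that $D_m\ge1/2$, $\eta_m^2\ge84D_m/5$ and $\sum_m\exp[-\eta_m^2/84]<\infty$; let $S=\bigcup_mS_m$, $\eta(t)=\inf\{\eta_m : S_m\ni t\}$. For each pair of distinct $t,u\in S$ take a test $\psi_{t,u}(\boldsymbol{X})\in\{t,u\}$ with $\mathbb{P}_\mu[\psi_{t,u}=u]\le\exp[-(H^2(t,u)-\eta^2(t)+\eta^2(u))/4]$ whenever $H(\mu,\mu_t)\le H(t,u)/4$, $\mathbb{P}_\mu[\psi_{t,u}=t]\le\exp[-(H^2(t,u)-\eta^2(u)+\eta^2(t))/4]$ whenever $H(\mu,\mu_u)\le H(t,u)/4$, and $\mathbb{P}_\mu[\psi_{t,u}=u]\le\exp[(16H^2(\mu,\mu_t)+\eta^2(t)-\eta^2(u))/4]$ for all finite measures $\mu$ (such tests exist). A T-estimator is a measurable minimizer over $t\in S$ of $\mathcal{D}_{\boldsymbol{X}}(t)=\sup\{H(t,u)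 : u\in S,u\ne t,\psi_{t,u}(\boldsymbol{X})=u\}$ ($\sup\emptyset=0$). *)

theory Defs
  imports "HOL-Probability.Probability"
begin

section \<open>Poisson processes with a finite mean measure\<close>

text \<open>
  A realization of the process is a finite multiset of points, since points may coincide when the
  mean measure has atoms. The sigma-algebra is the usual one, generated by the counting maps.
\<close>

definition configs :: "'a measure \<Rightarrow> 'a multiset measure" where
  "configs M = sigma {X. set_mset X \<subseteq> space M}
     {{X. set_mset X \<subseteq> space M \<and> size (filter_mset (\<lambda>x. x \<in> A) X) = k} | A k. A \<in> sets M}"

text \<open>
  The law of a Poisson process with finite mean measure \<open>\<mu>\<close>: the number of points is Poisson with
  parameter \<open>\<mu>(space \<mu>)\<close> and, given that there are \<open>n\<close> points, these are i.i.d. with the normalized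
  distribution \<open>\<mu> / \<mu>(space \<mu>)\<close>. The zero measure is treated separately because
  \<^const>\<open>poisson_pmf\<close> requires a positive parameter; the process is then almost surely empty.
\<close>

definition poisson_process :: "'a measure \<Rightarrow> 'a multiset measure" where
  "poisson_process \<mu> =
     (if emeasure \<mu> (space \<mu>) = 0 then return (configs \<mu>) {#}
      else bind (measure_pmf (poisson_pmf (measure \<mu> (space \<mu>))))
             (\<lambda>n. distr (PiM {..<n} (\<lambda>_. uniform_measure \<mu> (space \<mu>))) (configs \<mu>)
                    (\<lambda>x. image_mset x (mset_set {..<n}))))"


section \<open>Hellinger distance\<close>

definition add_measure :: "'a measure \<Rightarrow> 'a measure \<Rightarrow> 'a measure" where
  "add_measure \<mu> \<mu>' = measure_of (space \<mu>) (sets \<mu>) (\<lambda>A. emeasure \<mu> A + emeasure \<mu>' A)"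

text \<open>
  We use the dominating measure \<open>\<nu> = \<mu> + \<mu>'\<close>; lemma \<open>hellinger_density\<close> below shows that every
  other sigma-finite dominating measure gives the same value.
\<close>

definition hellinger :: "'a measure \<Rightarrow> 'a measure \<Rightarrow> real" where
  "hellinger \<mu> \<mu>' =
     (let \<nu> = add_measure \<mu> \<mu>' in
      sqrt (1/2 * (\<integral>x. (sqrt (enn2real (RN_deriv \<nu> \<mu> x)) - sqrt (enn2real (RN_deriv \<nu> \<mu>' x)))\<^sup>2 \<partial>\<nu>)))"

definition leb_on :: "real set \<Rightarrow> real measure" where
  "leb_on J = restrict_space lborel J"

text \<open>
  Elements of \<open>L\<^sub>1\<^sup>+\<close> are represented by functions. Their values outside \<open>J\<close> are irrelevant, and
  functions that are almost everywhere equal on \<open>J\<close> represent the same element.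
\<close>

definition L1plus :: "real set \<Rightarrow> (real \<Rightarrow> real) set" where
  "L1plus J = {t. integrable (leb_on J) t \<and> (\<forall>x\<in>J. 0 \<le> t x)}"

definition mean_measure :: "real set \<Rightarrow> (real \<Rightarrow> real) \<Rightarrow> real measure" where
  "mean_measure J t = density (leb_on J) (\<lambda>x. ennreal (t x))"

definition hdist :: "real set \<Rightarrow> (real \<Rightarrow> real) \<Rightarrow> (real \<Rightarrow> real) \<Rightarrow> real" where
  "hdist J t u = hellinger (mean_measure J t) (mean_measure J u)"


section \<open>Variation\<close>

definition power_variation :: "real \<Rightarrow> (real \<Rightarrow> real) \<Rightarrow> real set \<Rightarrow> ennreal" where
  "power_variation p f J =
     Sup {ennreal (\<Sum>j=1..i. \<bar>f (x j) - f (x (j - 1))\<bar> powr p) | (i::nat) (x::nat \<Rightarrow> real).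
            1 \<le> i \<and> (\<forall>j<i. x j < x (Suc j)) \<and> (\<forall>j\<le>i. x j \<in> J)}"

definition alpha_variation :: "real \<Rightarrow> (real \<Rightarrow> real) \<Rightarrow> real set \<Rightarrow> ennreal" where
  "alpha_variation \<alpha> f J =
     (if power_variation (1/\<alpha>) f J = \<infinity> then \<infinity>
      else ennreal (enn2real (power_variation (1/\<alpha>) f J) powr \<alpha>))"


section \<open>T-estimators\<close>

definition D_model ::
    "'a set \<Rightarrow> ('a \<Rightarrow> 'a \<Rightarrow> real) \<Rightarrow> 'a set \<Rightarrow> real \<Rightarrow> real \<Rightarrow> real \<Rightarrow> bool" where
  "D_model M d S' \<eta> D B \<longleftrightarrow>
     S' \<subseteq> M \<and> 0 < \<eta> \<and> 0 < D \<and> 0 < B \<and>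
     (\<forall>t\<in>M. \<forall>x\<ge>2. finite {u \<in> S'. d t u < x * \<eta>} \<and>
                    real (card {u \<in> S'. d t u < x * \<eta>}) \<le> B * exp (D * x\<^sup>2))"

text \<open>
  Countable families of models are indexed by a set \<open>I\<close> of natural numbers. The last condition
  says that every element of \<open>L\<^sub>1\<^sup>+\<close> has at most one representative in the union of the models, so
  that distinct functions in the models are distinct elements of \<open>L\<^sub>1\<^sup>+\<close>.
\<close>

definition model_family ::
    "real set \<Rightarrow> nat set \<Rightarrow> (nat \<Rightarrow> (real \<Rightarrow> real) set) \<Rightarrow> (nat \<Rightarrow> real) \<Rightarrow> (nat \<Rightarrow> real) \<Rightarrow> real \<Rightarrow> bool"
  where
  "model_family J I S \<eta> D B \<longleftrightarrow>
     (\<forall>m\<in>I. D_model (L1plus J) (hdist J) (S m) (\<eta> m) (D m) B \<and>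
             1/2 \<le> D m \<and> 84 * D m / 5 \<le> (\<eta> m)\<^sup>2) \<and>
     (\<lambda>m. exp (- (\<eta> m)\<^sup>2 / 84)) summable_on I \<and>
     (\<forall>t\<in>\<Union>m\<in>I. S m. \<forall>u\<in>\<Union>m\<in>I. S m. (AE x in leb_on J. t x = u x) \<longrightarrow> t = u)"

definition eta_of :: "nat set \<Rightarrow> (nat \<Rightarrow> 'a set) \<Rightarrow> (nat \<Rightarrow> real) \<Rightarrow> 'a \<Rightarrow> real" where
  "eta_of I S \<eta> t = Inf {\<eta> m | m. m \<in> I \<and> t \<in> S m}"

text \<open>
  There is one test for each unordered pair \<open>{t, u}\<close>, whence \<open>\<psi> t u = \<psi> u t\<close>. In
  \<open>test_family J S et \<psi>\<close>, the function \<open>et\<close> is \<open>t \<mapsto> \<eta>(t)\<close>.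
\<close>

definition test_family ::
    "real set \<Rightarrow> (real \<Rightarrow> real) set \<Rightarrow> ((real \<Rightarrow> real) \<Rightarrow> real) \<Rightarrow>
     ((real \<Rightarrow> real) \<Rightarrow> (real \<Rightarrow> real) \<Rightarrow> real multiset \<Rightarrow> (real \<Rightarrow> real)) \<Rightarrow> bool" where
  "test_family J S et \<psi> \<longleftrightarrow>
     (\<forall>t\<in>S. \<forall>u\<in>S. t \<noteq> u \<longrightarrow>
        \<psi> t u = \<psi> u t \<and>
        \<psi> t u \<in> measurable (configs (leb_on J)) (count_space {t, u}) \<and>
        (\<forall>\<mu>. finite_measure \<mu> \<and> sets \<mu> = sets (leb_on J) \<longrightarrow>
           (hellinger \<mu> (mean_measure J t) \<le> hdist J t u / 4 \<longrightarrow>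
              \<P>(X in poisson_process \<mu>. \<psi> t u X = u)
                \<le> exp (- ((hdist J t u)\<^sup>2 - (et t)\<^sup>2 + (et u)\<^sup>2) / 4)) \<and>
           (hellinger \<mu> (mean_measure J u) \<le> hdist J t u / 4 \<longrightarrow>
              \<P>(X in poisson_process \<mu>. \<psi> t u X = t)
                \<le> exp (- ((hdist J t u)\<^sup>2 - (et u)\<^sup>2 + (et t)\<^sup>2) / 4)) \<and>
           \<P>(X in poisson_process \<mu>. \<psi> t u X = u)
             \<le> exp ((16 * (hellinger \<mu> (mean_measure J t))\<^sup>2 + (et t)\<^sup>2 - (et u)\<^sup>2) / 4)))"

definition T_criterion ::
    "real set \<Rightarrow> (real \<Rightarrow> real) set \<Rightarrow>
     ((real \<Rightarrow> real) \<Rightarrow> (real \<Rightarrow> real) \<Rightarrow> real multiset \<Rightarrow> (real \<Rightarrow> real)) \<Rightarrow>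
     real multiset \<Rightarrow> (real \<Rightarrow> real) \<Rightarrow> ennreal" where
  "T_criterion J S \<psi> X t = (SUP u\<in>{u\<in>S. u \<noteq> t \<and> \<psi> t u X = u}. ennreal (hdist J t u))"

text \<open>
  The set \<open>S\<close> of candidates is countable, and measurability of the minimizer is understood with
  respect to its discrete sigma-algebra.
\<close>

definition T_estimator :: "real set \<Rightarrow> (real multiset \<Rightarrow> (real \<Rightarrow> real)) \<Rightarrow> bool" where
  "T_estimator J est \<longleftrightarrow>
     (\<exists>I S \<eta> D B \<psi>.
        model_family J I S \<eta> D B \<and>
        test_family J (\<Union>m\<in>I. S m) (eta_of I S \<eta>) \<psi> \<and>
        est \<in> measurable (configs (leb_on J)) (count_space (\<Union>m\<in>I. S m)) \<and>
        (\<forall>X\<in>space (configs (leb_on J)). \<forall>t\<in>\<Union>m\<in>I. S m.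
           T_criterion J (\<Union>m\<in>I. S m) \<psi> X (est X) \<le> T_criterion J (\<Union>m\<in>I. S m) \<psi> X t))"


section \<open>Basic properties\<close>

lemma space_configs: "space (configs M) = {X. set_mset X \<subseteq> space M}"
  unfolding configs_def by (subst space_measure_of) auto

lemma sets_configs:
  "sets (configs M) = sigma_sets {X. set_mset X \<subseteq> space M}
     {{X. set_mset X \<subseteq> space M \<and> size (filter_mset (\<lambda>x. x \<in> A) X) = k} | A k. A \<in> sets M}"
  unfolding configs_def by (subst sets_measure_of) auto

lemma configs_cong:
  assumes "sets M = sets N"
  shows "configs M = configs N"
  unfolding configs_def using assms sets_eq_imp_space_eq[OF assms] by simp

lemma measurable_mset_of_tuple:
  assumes N: "sets N = sets M"
  shows "(\<lambda>x. image_mset x (mset_set {..<n::nat})) \<in> measurable (PiM {..<n} (\<lambda>_. N)) (configs M)"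
proof (rule measurable_sigma_sets[OF sets_configs])
  show "{{X. set_mset X \<subseteq> space M \<and> size (filter_mset (\<lambda>x. x \<in> A) X) = k} | A k. A \<in> sets M}
          \<subseteq> Pow {X. set_mset X \<subseteq> space M}" by auto
  have sp: "space N = space M" by (rule sets_eq_imp_space_eq[OF N])
  show "(\<lambda>x. image_mset x (mset_set {..<n})) \<in> space (PiM {..<n} (\<lambda>_. N)) \<rightarrow> {X. set_mset X \<subseteq> space M}"
    by (auto simp: space_PiM sp PiE_def)
  fix Y assume "Y \<in> {{X. set_mset X \<subseteq> space M \<and> size (filter_mset (\<lambda>x. x \<in> A) X) = k} | A k. A \<in> sets M}"
  then obtain A k where A: "A \<in> sets N"
    and Y: "Y = {X. set_mset X \<subseteq> space M \<and> size (filter_mset (\<lambda>x. x \<in> A) X) = k}"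
    using N by auto
  have count: "size (filter_mset (\<lambda>y. y \<in> A) (image_mset x (mset_set {..<n})))
      = (\<Sum>i<n. if x i \<in> A then 1 else 0)" for x :: "nat \<Rightarrow> 'a"
    by (simp add: filter_mset_image_mset sum.If_cases Int_def)
  have [measurable]: "(\<lambda>x. (\<Sum>i<n. if x i \<in> A then 1 else 0 :: nat)) \<in> measurable (PiM {..<n} (\<lambda>_. N)) (count_space UNIV)"
    using A by measurable
  have "(\<lambda>x. image_mset x (mset_set {..<n})) -` Y \<inter> space (PiM {..<n} (\<lambda>_. N))
      = {x \<in> space (PiM {..<n} (\<lambda>_. N)). (\<Sum>i<n. if x i \<in> A then 1 else 0) = k}"
    unfolding Y using count by (auto simp: space_PiM sp PiE_def)
  also have "\<dots> \<in> sets (PiM {..<n} (\<lambda>_. N))"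
    by measurable
  finally show "(\<lambda>x. image_mset x (mset_set {..<n})) -` Y \<inter> space (PiM {..<n} (\<lambda>_. N))
      \<in> sets (PiM {..<n} (\<lambda>_. N))" .
qed

lemma
  assumes "finite_measure \<mu>"
  shows prob_space_poisson_process: "prob_space (poisson_process \<mu>)"
    and sets_poisson_process: "sets (poisson_process \<mu>) = sets (configs \<mu>)"
proof -
  interpret finite_measure \<mu> by fact
  have "prob_space (poisson_process \<mu>) \<and> sets (poisson_process \<mu>) = sets (configs \<mu>)"
  proof (cases "emeasure \<mu> (space \<mu>) = 0")
    case True
    then show ?thesis
      by (auto simp: poisson_process_def space_configs intro!: prob_space_return)
  next
    case False
    let ?U = "uniform_measure \<mu> (space \<mu>)"
    let ?k = "\<lambda>n::nat. distr (PiM {..<n} (\<lambda>_. ?U)) (configs \<mu>) (\<lambda>x. image_mset x (mset_set {..<n}))"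
    have U: "prob_space ?U"
      using False by (intro prob_space_uniform_measure) (auto simp: emeasure_eq_measure)
    have k: "prob_space (?k n)" for n
      by (rule prob_space.prob_space_distr[OF prob_space_PiM[OF U] measurable_mset_of_tuple]) simp
    have meas: "?k \<in> measurable (measure_pmf p) (subprob_algebra (configs \<mu>))" for p :: "nat pmf"
      using k by (auto simp: space_subprob_algebra measurable_def intro: prob_space_imp_subprob_space)
    have "prob_space (measure_pmf p \<bind> ?k)" for p :: "nat pmf"
      by (rule prob_space.prob_space_bind[OF prob_space_measure_pmf _ meas]) (simp add: k)
    moreover have "sets (measure_pmf p \<bind> ?k) = sets (configs \<mu>)" for p :: "nat pmf"
      by (rule sets_bind) auto
    ultimately show ?thesis
      using False by (simp add: poisson_process_def)
  qed
  then show "prob_space (poisson_process \<mu>)" "sets (poisson_process \<mu>) = sets (configs \<mu>)"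
    by auto
qed

lemma hellinger_density:
  fixes f g :: "'a \<Rightarrow> real"
  assumes \<nu>: "sigma_finite_measure \<nu>"
    and f: "integrable \<nu> f" "\<And>x. x \<in> space \<nu> \<Longrightarrow> 0 \<le> f x"
    and g: "integrable \<nu> g" "\<And>x. x \<in> space \<nu> \<Longrightarrow> 0 \<le> g x"
  shows "hellinger (density \<nu> (\<lambda>x. ennreal (f x))) (density \<nu> (\<lambda>x. ennreal (g x)))
           = sqrt (1/2 * (\<integral>x. (sqrt (f x) - sqrt (g x))\<^sup>2 \<partial>\<nu>))"
proof -
  have [measurable]: "f \<in> borel_measurable \<nu>" "g \<in> borel_measurable \<nu>"
    using f g by auto
  let ?F = "density \<nu> (\<lambda>x. ennreal (f x))" and ?G = "density \<nu> (\<lambda>x. ennreal (g x))"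
  let ?h = "\<lambda>x. f x + g x"
  let ?\<sigma> = "density \<nu> (\<lambda>x. ennreal (?h x))"
  have sum: "add_measure ?F ?G = ?\<sigma>"
  proof (rule measure_eqI)
    show sets: "sets (add_measure ?F ?G) = sets ?\<sigma>"
      unfolding add_measure_def using sets.sigma_sets_eq[of \<nu>]
      by (simp add: sets_measure_of sets.space_closed)
    fix A assume "A \<in> sets (add_measure ?F ?G)"
    then have A: "A \<in> sets \<nu>" using sets by simp
    have eq: "emeasure ?F A + emeasure ?G A = emeasure ?\<sigma> A" if A: "A \<in> sets \<nu>" for A
    proof -
      have "emeasure ?F A + emeasure ?G A
          = (\<integral>\<^sup>+x. ennreal (f x) * indicator A x + ennreal (g x) * indicator A x \<partial>\<nu>)"
        using A by (simp add: emeasure_density nn_integral_add)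
      also have "\<dots> = (\<integral>\<^sup>+x. ennreal (?h x) * indicator A x \<partial>\<nu>)"
        using f g by (intro nn_integral_cong) (auto simp: indicator_def)
      finally show ?thesis using A by (simp add: emeasure_density)
    qed
    have "add_measure ?F ?G = measure_of (space \<nu>) (sets \<nu>) (emeasure ?\<sigma>)"
      unfolding add_measure_def by (subst measure_of_eq[where \<mu>' = "emeasure ?\<sigma>"])
        (auto simp: sets.space_closed sets.sigma_sets_eq eq)
    also have "\<dots> = ?\<sigma>" using measure_of_of_measure[of ?\<sigma>] by simp
    finally show "emeasure (add_measure ?F ?G) A = emeasure ?\<sigma> A" by simp
  qed
  have fin: "finite_measure (density \<nu> (\<lambda>x. ennreal (k x)))"
    if "integrable \<nu> k" "\<And>x. x \<in> space \<nu> \<Longrightarrow> 0 \<le> k x" for k :: "'a \<Rightarrow> real"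
  proof
    have "emeasure (density \<nu> (\<lambda>x. ennreal (k x))) (space \<nu>) = (\<integral>\<^sup>+x. ennreal (k x) \<partial>\<nu>)"
      using that by (subst emeasure_density) (auto intro!: nn_integral_cong)
    also have "\<dots> < \<infinity>"
      using nn_integral_eq_integral[OF that(1)] that(2) by (simp add: AE_I2)
    finally show "emeasure (density \<nu> (\<lambda>x. ennreal (k x))) (space (density \<nu> (\<lambda>x. ennreal (k x)))) \<noteq> \<infinity>"
      by simp
  qed
  interpret \<sigma>: finite_measure ?\<sigma>
    by (rule fin) (use f g in auto)
  have RN: "AE x in ?\<sigma>. ennreal (k x / ?h x) = RN_deriv ?\<sigma> (density \<nu> (\<lambda>x. ennreal (k x))) x"
    if [measurable]: "k \<in> borel_measurable \<nu>"
      and k: "\<And>x. x \<in> space \<nu> \<Longrightarrow> 0 \<le> k x \<and> k x \<le> ?h x" for k :: "'a \<Rightarrow> real"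
  proof (rule \<sigma>.RN_deriv_unique)
    show "(\<lambda>x. ennreal (k x / ?h x)) \<in> borel_measurable ?\<sigma>" by simp
    have "density ?\<sigma> (\<lambda>x. ennreal (k x / ?h x)) = density \<nu> (\<lambda>x. ennreal (?h x) * ennreal (k x / ?h x))"
      by (rule density_density_eq) auto
    also have "\<dots> = density \<nu> (\<lambda>x. ennreal (k x))"
    proof (rule density_cong)
      show "AE x in \<nu>. ennreal (?h x) * ennreal (k x / ?h x) = ennreal (k x)"
      proof (rule AE_I2)
        fix x assume x: "x \<in> space \<nu>"
        have "?h x * (k x / ?h x) = k x" using k[OF x] by (cases "?h x = 0") auto
        then show "ennreal (?h x) * ennreal (k x / ?h x) = ennreal (k x)"
          using f(2)[OF x] g(2)[OF x] k[OF x] by (metis ennreal_mult' add_nonneg_nonneg)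
      qed
    qed auto
    finally show "density ?\<sigma> (\<lambda>x. ennreal (k x / ?h x)) = density \<nu> (\<lambda>x. ennreal (k x))" .
  qed
  have pos: "AE x in ?\<sigma>. x \<in> space \<nu>" using AE_space[of ?\<sigma>] by simp
  have "(\<integral>x. (sqrt (enn2real (RN_deriv ?\<sigma> ?F x)) - sqrt (enn2real (RN_deriv ?\<sigma> ?G x)))\<^sup>2 \<partial>?\<sigma>)
      = (\<integral>x. (sqrt (f x / ?h x) - sqrt (g x / ?h x))\<^sup>2 \<partial>?\<sigma>)"
  proof (rule integral_cong_AE)
    have "AE x in ?\<sigma>. ennreal (f x / ?h x) = RN_deriv ?\<sigma> ?F x" by (rule RN) (use f g in auto)
    moreover have "AE x in ?\<sigma>. ennreal (g x / ?h x) = RN_deriv ?\<sigma> ?G x" by (rule RN) (use f g in auto)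
    ultimately show "AE x in ?\<sigma>. (sqrt (enn2real (RN_deriv ?\<sigma> ?F x)) - sqrt (enn2real (RN_deriv ?\<sigma> ?G x)))\<^sup>2
        = (sqrt (f x / ?h x) - sqrt (g x / ?h x))\<^sup>2"
      using pos
    proof eventually_elim
      case (elim x)
      then have "enn2real (RN_deriv ?\<sigma> ?F x) = f x / ?h x" "enn2real (RN_deriv ?\<sigma> ?G x) = g x / ?h x"
        using f(2)[of x] g(2)[of x] by (auto simp flip: elim(1,2))
      then show ?case by simp
    qed
  qed auto
  also have "\<dots> = (\<integral>x. ?h x * (sqrt (f x / ?h x) - sqrt (g x / ?h x))\<^sup>2 \<partial>\<nu>)"
    by (subst integral_density) (use f g in \<open>auto intro: AE_I2\<close>)
  also have "\<dots> = (\<integral>x. (sqrt (f x) - sqrt (g x))\<^sup>2 \<partial>\<nu>)"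
  proof (rule Bochner_Integration.integral_cong)
    fix x assume x: "x \<in> space \<nu>"
    then have nn: "0 \<le> f x" "0 \<le> g x" using f g by auto
    show "?h x * (sqrt (f x / ?h x) - sqrt (g x / ?h x))\<^sup>2 = (sqrt (f x) - sqrt (g x))\<^sup>2"
    proof (cases "?h x = 0")
      case True
      then show ?thesis using nn by (simp add: add_nonneg_eq_0_iff)
    next
      case False
      then have h: "0 < ?h x" using nn by linarith
      have "(sqrt (f x / ?h x) - sqrt (g x / ?h x))\<^sup>2 = ((sqrt (f x) - sqrt (g x)) / sqrt (?h x))\<^sup>2"
        by (simp add: real_sqrt_divide diff_divide_distrib)
      also have "\<dots> = (sqrt (f x) - sqrt (g x))\<^sup>2 / ?h x"
        using h by (simp add: power_divide)
      finally show ?thesis using h by simp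
    qed
  qed auto
  finally show ?thesis unfolding hellinger_def sum by simp
qed

lemma hdist_eq:
  assumes "J \<in> sets borel" "t \<in> L1plus J" "u \<in> L1plus J"
  shows "hdist J t u = sqrt (1/2 * (\<integral>x. (sqrt (t x) - sqrt (u x))\<^sup>2 \<partial>leb_on J))"
proof -
  have "sigma_finite_measure (leb_on J)"
    unfolding leb_on_def using assms(1)
    by (intro sigma_finite_measure_restrict_space) (auto intro: sigma_finite_lborel)
  then show ?thesis
    unfolding hdist_def mean_measure_def using assms
    by (intro hellinger_density) (auto simp: L1plus_def leb_on_def space_restrict_space)
qed

end

theory Submission
  imports Defs
begin

text \<open>
  The square roots of intensities live in a Hilbert space in which the Hellinger distance is, up to
  the factor \<open>2\<^sup>-\<^sup>1\<^sup>/\<^sup>2\<close>, the norm distance. The estimator selects among squares of step functions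
  on dyadic partitions of \<open>J\<close>. The proof combines robust tests, a count of the candidates, a bound
  on the risk of the selection, and an approximation of \<open>\<surd>s\<close>.

  To test between \<open>t\<close> and \<open>u\<close>, write \<open>f = \<surd>t\<close> and \<open>g = \<surd>u\<close>. The likelihood ratio test
  between the two points at one quarter and at three quarters of the segment from \<open>f\<close> to \<open>g\<close> is
  robust: the exponential moment of its statistic, half the log-likelihood ratio, under a Poisson process with an arbitrary finite mean measure \<open>\<mu>\<close> is at most
  \<open>exp (4 H\<^sup>2(\<mu>, \<mu>\<^sub>t) - H\<^sup>2(t, u) / 2)\<close>. This follows from an explicit formula for such moments
  (\<open>nn_integral_exp_poisson_process\<close>) and a pointwise inequality
  (\<open>ratio_test_pointwise\<close>); Markov's inequality then gives all the required error bounds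
  (\<open>test_family_ratio_test\<close>).

  A model consists of the step functions given by binary trees with \<open>N\<close> leaves, the
  value on a cell of length \<open>l\<close> being \<open>k / \<surd>l\<close> with an integer \<open>k\<close>. Give a tree the weight
  \<open>c\<^sup>-\<^sup>N exp (- \<parallel>g - step\<parallel>\<^sup>2 / 84)\<close>. Whatever the square integrable function \<open>g\<close> is, the total
  weight of all trees is at most \<open>1/2\<close> (\<open>weighted_tree_sum_le\<close>): a single leaf contributes a
  convergent Gaussian sum, and a tree splits into two subtrees on which the squared error is
  additive. This single estimate makes every model a D-model of dimension proportional to \<open>N\<close>
  (\<open>D_model_tree_model\<close>), without a logarithmic factor for the choice of the
  partition, and it also bounds the sum of error probabilities over all models
  (\<open>tree_penalised_sum_le\<close>).

  If \<open>t\<close> is a candidate, the distance from \<open>t\<close> to the T-estimator is at most the largest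
  distance from \<open>t\<close> to a candidate that beats \<open>t\<close>. Its \<open>q\<close>-th power is bounded by the sum over all
  candidates that beat \<open>t\<close> from far away, and the expectation of that sum is controlled by the
  counting estimate (\<open>T_estimator_risk\<close>).

  For the approximation, let \<open>p = 1/\<alpha>\<close>. Split a cell of length \<open>l\<close> as long as \<open>l\<^sup>p\<^sup>/\<^sup>2\<close> times the
  \<open>p\<close>-variation of \<open>\<surd>s\<close> on it exceeds 1. On a final cell the squared error is bounded by a constant.
  The \<open>p\<close>-variation is superadditive over cells, so at most \<open>5 (\<surd>L V)\<^sup>2\<^sup>/\<^sup>(\<^sup>2\<^sup>\<alpha>\<^sup>+\<^sup>1\<^sup>)\<close> cells
  arise when \<open>\<surd>L V > 1\<close> (\<open>ex_tree_approximation\<close>). Squared bias and dimension are then both of the order of the number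
  of cells, which is the asserted rate.
\<close>

section \<open>Linear statistics of a Poisson process\<close>

text \<open>
  The counting maps are measurable by definition, hence so are sums of simple functions over the
  points; the general case is a pointwise limit, since every configuration is finite.
\<close>

lemma measurable_sum_mset_configs:
  fixes \<phi> :: "'a \<Rightarrow> real"
  assumes \<phi>: "\<phi> \<in> borel_measurable M"
  shows "(\<lambda>X. \<Sum>x\<in>#X. \<phi> x) \<in> borel_measurable (configs M)"
proof -
  have count: "(\<lambda>X. real (size (filter_mset (\<lambda>x. x \<in> A) X))) \<in> borel_measurable (configs M)"
    if A: "A \<in> sets M" for A
  proof -
    have "(\<lambda>X. size (filter_mset (\<lambda>x. x \<in> A) X)) \<in> measurable (configs M) (count_space UNIV)"
    proof (subst measurable_count_space_eq2_countable, safe)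
      fix k
      have "(\<lambda>X. size (filter_mset (\<lambda>x. x \<in> A) X)) -` {k} \<inter> space (configs M)
          = {X. set_mset X \<subseteq> space M \<and> size (filter_mset (\<lambda>x. x \<in> A) X) = k}"
        by (auto simp: space_configs)
      also have "\<dots> \<in> sets (configs M)"
        unfolding sets_configs using A by (intro sigma_sets.Basic) auto
      finally show "(\<lambda>X. size (filter_mset (\<lambda>x. x \<in> A) X)) -` {k} \<inter> space (configs M) \<in> sets (configs M)" .
    qed auto
    then show ?thesis by measurable
  qed
  have indicator_sum: "(\<Sum>x\<in>#X. indicator A x) = real (size (filter_mset (\<lambda>x. x \<in> A) X))"
    for A :: "'a set" and X
    by (induction X) auto
  have simple: "(\<lambda>X. \<Sum>x\<in>#X. f x) \<in> borel_measurable (configs M)" if f: "simple_function M f" for f :: "'a \<Rightarrow> real"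
  proof -
    have "(\<Sum>x\<in>#X. f x) = (\<Sum>v\<in>f ` space M. v * real (size (filter_mset (\<lambda>x. x \<in> f -` {v} \<inter> space M) X)))"
      if X: "X \<in> space (configs M)" for X
    proof -
      have "(\<Sum>x\<in>#X. f x) = (\<Sum>x\<in>#X. \<Sum>v\<in>f ` space M. v * indicator (f -` {v} \<inter> space M) x)"
      proof (rule arg_cong[where f = sum_mset], rule image_mset_cong)
        fix x assume "x \<in># X"
        then have x: "x \<in> space M" using X by (auto simp: space_configs)
        have "(\<Sum>v\<in>f ` space M. v * indicator (f -` {v} \<inter> space M) x) = (\<Sum>v\<in>f ` space M. if v = f x then f x else 0)"
          using x by (intro sum.cong) (auto simp: indicator_def)
        also have "\<dots> = f x"
          using simple_functionD(1)[OF f] x by (simp add: sum.delta)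
        finally show "f x = (\<Sum>v\<in>f ` space M. v * indicator (f -` {v} \<inter> space M) x)" by simp
      qed
      also have "\<dots> = (\<Sum>v\<in>f ` space M. \<Sum>x\<in>#X. v * indicator (f -` {v} \<inter> space M) x)"
        by (induction X) (auto simp: sum.distrib)
      also have "\<dots> = (\<Sum>v\<in>f ` space M. v * (\<Sum>x\<in>#X. indicator (f -` {v} \<inter> space M) x))"
        by (simp add: sum_mset_distrib_left)
      finally show ?thesis by (simp add: indicator_sum)
    qed
    moreover have "(\<lambda>X. \<Sum>v\<in>f ` space M. v * real (size (filter_mset (\<lambda>x. x \<in> f -` {v} \<inter> space M) X)))
        \<in> borel_measurable (configs M)"
      by (intro borel_measurable_sum borel_measurable_times borel_measurable_const count simple_functionD(2)[OF f])
    ultimately show ?thesis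
      by (rule measurable_cong[THEN iffD2])
  qed
  obtain F where F: "\<And>i. simple_function M (F i)" "\<And>x. x \<in> space M \<Longrightarrow> (\<lambda>i. F i x) \<longlonglongrightarrow> \<phi> x"
    using borel_measurable_implies_sequence_metric[OF \<phi>] by blast
  show ?thesis
  proof (rule borel_measurable_LIMSEQ_metric)
    fix X assume "X \<in> space (configs M)"
    then have "set_mset X \<subseteq> space M" by (simp add: space_configs)
    then show "(\<lambda>i. \<Sum>x\<in>#X. F i x) \<longlonglongrightarrow> (\<Sum>x\<in>#X. \<phi> x)"
      by (induction X) (auto intro!: tendsto_add F(2))
  qed (rule simple[OF F(1)])
qed

text \<open>
  With \<open>m\<close> the total mass and \<open>c = \<integral> exp \<phi> d\<mu>\<close>, the expectation given \<open>n\<close> points is \<open>(c / m)\<^sup>n\<close> by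
  independence, and averaging over the Poisson law of \<open>n\<close> gives \<open>exp (c - m)\<close>.
\<close>

theorem nn_integral_exp_poisson_process:
  fixes \<phi> :: "'a \<Rightarrow> real"
  assumes \<mu>: "finite_measure \<mu>" and [measurable]: "\<phi> \<in> borel_measurable \<mu>"
    and int: "integrable \<mu> (\<lambda>x. exp (\<phi> x))"
  shows "(\<integral>\<^sup>+X. ennreal (exp (\<Sum>x\<in>#X. \<phi> x)) \<partial>poisson_process \<mu>) = ennreal (exp (\<integral>x. exp (\<phi> x) - 1 \<partial>\<mu>))"
proof -
  interpret finite_measure \<mu> by fact
  have meas: "(\<lambda>X. ennreal (exp (\<Sum>x\<in>#X. \<phi> x))) \<in> borel_measurable (configs \<mu>)"
    using measurable_sum_mset_configs[of \<phi> \<mu>] by measurable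
  show ?thesis
  proof (cases "emeasure \<mu> (space \<mu>) = 0")
    case True
    then have null: "AE x in \<mu>. False"
      by (intro AE_I[of _ _ "space \<mu>"]) auto
    have "(\<integral>x. exp (\<phi> x) - 1 \<partial>\<mu>) = (\<integral>x. 0 \<partial>\<mu>)"
      using null by (intro integral_cong_AE) (auto elim: eventually_mono)
    moreover have "(\<integral>\<^sup>+X. ennreal (exp (\<Sum>x\<in>#X. \<phi> x)) \<partial>poisson_process \<mu>) = 1"
      using meas True unfolding poisson_process_def
      by (simp add: nn_integral_return space_configs)
    ultimately show ?thesis by simp
  next
    case False
    define m where "m = measure \<mu> (space \<mu>)"
    have em: "emeasure \<mu> (space \<mu>) = ennreal m" by (simp add: m_def emeasure_eq_measure)
    have m: "m > 0" using False em by (metis ennreal_eq_0_iff not_less)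
    let ?U = "uniform_measure \<mu> (space \<mu>)"
    let ?k = "\<lambda>n::nat. distr (PiM {..<n} (\<lambda>_. ?U)) (configs \<mu>) (\<lambda>x. image_mset x (mset_set {..<n}))"
    define c where "c = (\<integral>x. exp (\<phi> x) \<partial>\<mu>)"
    have c0: "0 \<le> c" unfolding c_def by (rule integral_nonneg_AE) auto
    have U: "prob_space ?U"
      using False by (intro prob_space_uniform_measure) (auto simp: emeasure_eq_measure)
    interpret P: product_sigma_finite "\<lambda>_::nat. ?U"
      using U by (intro product_sigma_finite.intro prob_space_imp_sigma_finite)
    have k: "prob_space (?k n)" for n
      by (rule prob_space.prob_space_distr[OF prob_space_PiM[OF U] measurable_mset_of_tuple]) simp
    have km: "?k \<in> measurable (measure_pmf p) (subprob_algebra (configs \<mu>))" for p :: "nat pmf"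
      using k by (auto simp: space_subprob_algebra measurable_def intro: prob_space_imp_subprob_space)
    have one: "(\<integral>\<^sup>+x. ennreal (exp (\<phi> x)) \<partial>?U) = ennreal (c / m)"
    proof -
      have "(\<integral>\<^sup>+x. ennreal (exp (\<phi> x)) \<partial>?U) = (\<integral>\<^sup>+x. ennreal (exp (\<phi> x)) * indicator (space \<mu>) x \<partial>\<mu>) / ennreal m"
        by (subst nn_integral_uniform_measure) (auto simp: em)
      also have "(\<integral>\<^sup>+x. ennreal (exp (\<phi> x)) * indicator (space \<mu>) x \<partial>\<mu>) = (\<integral>\<^sup>+x. ennreal (exp (\<phi> x)) \<partial>\<mu>)"
        by (intro nn_integral_cong) auto
      also have "\<dots> = ennreal c" unfolding c_def using int by (intro nn_integral_eq_integral) auto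
      finally show ?thesis using m c0 by (simp add: divide_ennreal)
    qed
    have inner: "(\<integral>\<^sup>+X. ennreal (exp (\<Sum>x\<in>#X. \<phi> x)) \<partial>?k n) = ennreal ((c / m) ^ n)" for n
    proof -
      have "(\<integral>\<^sup>+X. ennreal (exp (\<Sum>x\<in>#X. \<phi> x)) \<partial>?k n)
          = (\<integral>\<^sup>+x. ennreal (exp (\<Sum>y\<in>#image_mset x (mset_set {..<n}). \<phi> y)) \<partial>PiM {..<n} (\<lambda>_. ?U))"
        using meas by (intro nn_integral_distr measurable_mset_of_tuple) auto
      also have "\<dots> = (\<integral>\<^sup>+x. (\<Prod>i\<in>{..<n}. ennreal (exp (\<phi> (x i)))) \<partial>PiM {..<n} (\<lambda>_. ?U))"
        by (simp add: image_mset.compositionality comp_def exp_sum prod_ennreal flip: sum_unfold_sum_mset)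
      also have "\<dots> = (\<Prod>i\<in>{..<n}. \<integral>\<^sup>+x. ennreal (exp (\<phi> x)) \<partial>?U)"
        by (rule P.product_nn_integral_prod) auto
      also have "\<dots> = ennreal ((c / m) ^ n)"
        unfolding one using m c0 by (simp add: ennreal_power)
      finally show ?thesis .
    qed
    have "(\<integral>\<^sup>+X. ennreal (exp (\<Sum>x\<in>#X. \<phi> x)) \<partial>poisson_process \<mu>)
        = (\<integral>\<^sup>+n. ennreal ((c / m) ^ n) \<partial>measure_pmf (poisson_pmf m))"
      using False unfolding poisson_process_def m_def[symmetric]
      by (simp add: nn_integral_bind[OF meas km] inner)
    also have "\<dots> = (\<Sum>n. ennreal (c ^ n / fact n * exp (- m)))"
    proof -
      have "ennreal (pmf (poisson_pmf m) n) * ennreal ((c / m) ^ n) = ennreal (c ^ n / fact n * exp (- m))" for n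
        using m c0 by (simp add: ennreal_mult[symmetric] power_divide field_simps)
      then show ?thesis
        by (simp add: nn_integral_measure_pmf nn_integral_count_space_nat)
    qed
    also have "\<dots> = ennreal (exp c * exp (- m))"
    proof (rule suminf_ennreal_eq)
      show "(\<lambda>n. c ^ n / fact n * exp (- m)) sums (exp c * exp (- m))"
        using exp_converges[of c] by (intro sums_mult2) (simp add: field_simps)
    qed (use c0 in auto)
    also have "exp c * exp (- m) = exp (\<integral>x. exp (\<phi> x) - 1 \<partial>\<mu>)"
      using int by (simp add: c_def m_def exp_add[symmetric])
    finally show ?thesis .
  qed
qed

text \<open>
  Markov's inequality for \<open>exp (\<Sum>x\<in>#X. \<phi> x)\<close>.
\<close>

corollary poisson_process_tail_bound:
  fixes \<phi> :: "'a \<Rightarrow> real"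
  assumes \<mu>: "finite_measure \<mu>" and \<phi>: "\<phi> \<in> borel_measurable \<mu>"
    and int: "integrable \<mu> (\<lambda>x. exp (\<phi> x))"
    and A: "\<And>X. X \<in> space (configs \<mu>) \<Longrightarrow> X \<in> A \<Longrightarrow> \<tau> \<le> (\<Sum>x\<in>#X. \<phi> x)"
  shows "\<P>(X in poisson_process \<mu>. X \<in> A) \<le> exp ((\<integral>x. exp (\<phi> x) - 1 \<partial>\<mu>) - \<tau>)"
proof -
  note sets = sets_poisson_process[OF \<mu>] and sp = sets_eq_imp_space_eq[OF sets_poisson_process[OF \<mu>]]
  interpret prob_space "poisson_process \<mu>" by (rule prob_space_poisson_process[OF \<mu>])
  have [measurable]: "(\<lambda>X. \<Sum>x\<in>#X. \<phi> x) \<in> borel_measurable (poisson_process \<mu>)"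
    using measurable_sum_mset_configs[OF \<phi>] sets by (simp cong: measurable_cong_sets)
  let ?B = "{X\<in>space (poisson_process \<mu>). \<tau> \<le> (\<Sum>x\<in>#X. \<phi> x)}"
  have "ennreal (\<P>(X in poisson_process \<mu>. X \<in> A)) \<le> ennreal (measure (poisson_process \<mu>) ?B)"
  proof (intro ennreal_leI finite_measure_mono)
    show "?B \<in> events" by measurable
  qed (use A in \<open>auto simp: sp\<close>)
  also have "\<dots> = (\<integral>\<^sup>+X. indicator ?B X \<partial>poisson_process \<mu>)"
    by (simp add: emeasure_eq_measure)
  also have "\<dots> \<le> (\<integral>\<^sup>+X. ennreal (exp (-\<tau>)) * ennreal (exp (\<Sum>x\<in>#X. \<phi> x)) \<partial>poisson_process \<mu>)"
  proof (rule nn_integral_mono)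
    fix X
    have "1 \<le> exp (-\<tau>) * exp (\<Sum>x\<in>#X. \<phi> x)" if "\<tau> \<le> (\<Sum>x\<in>#X. \<phi> x)"
      using that by (simp flip: exp_add)
    then show "indicator ?B X \<le> ennreal (exp (-\<tau>)) * ennreal (exp (\<Sum>x\<in>#X. \<phi> x))"
      by (auto simp: indicator_def simp flip: ennreal_mult ennreal_1)
  qed
  also have "\<dots> = ennreal (exp (-\<tau>)) * ennreal (exp (\<integral>x. exp (\<phi> x) - 1 \<partial>\<mu>))"
    by (simp add: nn_integral_cmult nn_integral_exp_poisson_process[OF \<mu> \<phi> int])
  also have "\<dots> = ennreal (exp ((\<integral>x. exp (\<phi> x) - 1 \<partial>\<mu>) - \<tau>))"
    by (simp flip: ennreal_mult exp_add)
  finally show ?thesis by simp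
qed

section \<open>Hellinger distances through common densities\<close>

text \<open>
  The tests must cope with every finite mean measure \<open>\<mu>\<close>, including those with a part singular to
  Lebesgue measure. Passing to densities with respect to \<open>\<mu> + \<rho>\<close> treats that part on the same footing
  as the rest.
\<close>

lemma ex_common_densities:
  assumes \<mu>: "finite_measure \<mu>" and \<rho>: "finite_measure \<rho>" and sets: "sets \<mu> = sets \<rho>"
  obtains \<nu> :: "'a measure" and m l :: "'a \<Rightarrow> real"
  where "finite_measure \<nu>" "sets \<nu> = sets \<rho>"
    "\<And>x. 0 \<le> m x" "\<And>x. 0 \<le> l x" "integrable \<nu> m" "integrable \<nu> l"
    "density \<nu> (\<lambda>x. ennreal (m x)) = \<mu>" "density \<nu> (\<lambda>x. ennreal (l x)) = \<rho>"
proof -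
  define \<nu> where "\<nu> = measure_of (space \<rho>) (sets \<rho>) (\<lambda>A. emeasure \<mu> A + emeasure \<rho> A)"
  have sets_\<nu>: "sets \<nu> = sets \<rho>"
    unfolding \<nu>_def by (simp add: sets.space_closed sets.sigma_sets_eq)
  have sp: "space \<nu> = space \<rho>" by (rule sets_eq_imp_space_eq[OF sets_\<nu>])
  have em: "emeasure \<nu> A = emeasure \<mu> A + emeasure \<rho> A" if "A \<in> sets \<rho>" for A
    unfolding \<nu>_def
  proof (rule emeasure_measure_of_sigma)
    show "sigma_algebra (space \<rho>) (sets \<rho>)" by (rule sets.sigma_algebra_axioms)
    show "countably_additive (sets \<rho>) (\<lambda>A. emeasure \<mu> A + emeasure \<rho> A)"
      unfolding countably_additive_def
      using suminf_emeasure[of _ \<mu>] suminf_emeasure[of _ \<rho>] by (auto simp: sets suminf_add[symmetric])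
  qed (use that in \<open>auto simp: positive_def\<close>)
  have fin: "finite_measure \<nu>"
  proof
    show "emeasure \<nu> (space \<nu>) \<noteq> \<infinity>"
      using finite_measure.emeasure_finite[OF \<mu>] finite_measure.emeasure_finite[OF \<rho>]
      by (simp add: em sp)
  qed
  interpret \<nu>: finite_measure \<nu> by (rule fin)
  have dens: "\<exists>h. (\<forall>x. 0 \<le> h x) \<and> integrable \<nu> h \<and> density \<nu> (\<lambda>x. ennreal (h x)) = \<kappa>"
    if \<kappa>: "finite_measure \<kappa>" "sets \<kappa> = sets \<rho>" and le: "\<And>A. A \<in> sets \<rho> \<Longrightarrow> emeasure \<kappa> A \<le> emeasure \<nu> A"
    for \<kappa> :: "'a measure"
  proof -
    have ac: "absolutely_continuous \<nu> \<kappa>"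
      unfolding absolutely_continuous_def
    proof
      fix N assume "N \<in> null_sets \<nu>"
      then show "N \<in> null_sets \<kappa>" using le[of N] by (auto simp: null_sets_def sets_\<nu> \<kappa>)
    qed
    obtain h where h: "h \<in> borel_measurable \<nu>" "AE x in \<nu>. RN_deriv \<nu> \<kappa> x = ennreal (h x)" "\<And>x. 0 \<le> h x"
      using \<nu>.real_RN_deriv[OF \<kappa>(1) ac] \<kappa>(2) sets_\<nu> by metis
    have "density \<nu> (\<lambda>x. ennreal (h x)) = density \<nu> (RN_deriv \<nu> \<kappa>)"
      using h by (intro density_cong) (auto elim: eventually_mono)
    also have "\<dots> = \<kappa>"
      using \<nu>.density_RN_deriv[OF ac] \<kappa>(2) sets_\<nu> by simp
    finally have eq: "density \<nu> (\<lambda>x. ennreal (h x)) = \<kappa>" .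
    have "(\<integral>\<^sup>+x. ennreal (h x) \<partial>\<nu>) = emeasure \<kappa> (space \<nu>)"
      unfolding eq[symmetric] using h(1) by (subst emeasure_density) (auto intro!: nn_integral_cong)
    then have "integrable \<nu> h"
      using h finite_measure.emeasure_finite[OF \<kappa>(1)] by (auto simp: integrable_iff_bounded less_top)
    then show ?thesis using h(3) eq by blast
  qed
  obtain m where m: "\<forall>x. 0 \<le> m x" "integrable \<nu> m" "density \<nu> (\<lambda>x. ennreal (m x)) = \<mu>"
    using dens[OF \<mu> sets] em by fastforce
  obtain l where l: "\<forall>x. 0 \<le> l x" "integrable \<nu> l" "density \<nu> (\<lambda>x. ennreal (l x)) = \<rho>"
    using dens[OF \<rho> refl] em by fastforce
  show ?thesis
    using that[OF fin sets_\<nu>] m l by blast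
qed

lemma finite_measure_leb_on:
  assumes "bounded J" "J \<in> sets borel"
  shows "finite_measure (leb_on J)"
  unfolding leb_on_def using assms emeasure_bounded_finite[OF assms(1)]
  by (intro finite_measureI) (simp add: emeasure_restrict_space space_restrict_space less_top)

lemma hellinger_nonneg: "0 \<le> hellinger \<mu> \<mu>'"
  by (auto simp: hellinger_def Let_def intro!: integral_nonneg_AE)

lemma space_leb_on: "space (leb_on J) = J"
  by (simp add: leb_on_def space_restrict_space)

lemma finite_measure_mean_measure: "s \<in> L1plus J \<Longrightarrow> finite_measure (mean_measure J s)"
proof (rule finite_measureI)
  assume s: "s \<in> L1plus J"
  have "emeasure (mean_measure J s) (space (mean_measure J s)) = (\<integral>\<^sup>+x. ennreal (s x) \<partial>leb_on J)"
    using s unfolding mean_measure_def L1plus_def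
    by (subst emeasure_density) (auto intro!: nn_integral_cong)
  also have "\<dots> < \<infinity>"
    using s by (subst nn_integral_eq_integral) (auto simp: L1plus_def space_leb_on)
  finally show "emeasure (mean_measure J s) (space (mean_measure J s)) \<noteq> \<infinity>" by simp
qed

lemma hdist_nonneg: "0 \<le> hdist J t u"
  by (simp add: hdist_def hellinger_nonneg)

lemma hdist_commute:
  assumes "J \<in> sets borel" "t \<in> L1plus J" "u \<in> L1plus J"
  shows "hdist J t u = hdist J u t"
  using assms by (simp add: hdist_eq power2_commute)

lemma add_square_le: "(a + b)\<^sup>2 \<le> 2 * a\<^sup>2 + 2 * b\<^sup>2" for a b :: real
  using zero_le_power2[of "a - b"] by (simp add: power2_sum power2_diff)

lemma integrable_sqrt_diff:
  fixes p q :: "'a \<Rightarrow> real"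
  assumes p: "integrable M p" "\<And>x. x \<in> space M \<Longrightarrow> 0 \<le> p x"
    and q: "integrable M q" "\<And>x. x \<in> space M \<Longrightarrow> 0 \<le> q x"
  shows "integrable M (\<lambda>x. (sqrt (p x) - sqrt (q x))\<^sup>2)"
proof (rule Bochner_Integration.integrable_bound)
  show "integrable M (\<lambda>x. p x + q x)" using p q by simp
  show "AE x in M. norm ((sqrt (p x) - sqrt (q x))\<^sup>2) \<le> norm (p x + q x)"
  proof (rule AE_I2)
    fix x assume "x \<in> space M"
    then have x: "0 \<le> p x" "0 \<le> q x" using p q by auto
    have "(sqrt (p x) - sqrt (q x))\<^sup>2 = p x + q x - 2 * (sqrt (p x) * sqrt (q x))"
      using x by (simp add: power2_diff)
    moreover have "0 \<le> sqrt (p x) * sqrt (q x)" using x by simp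
    ultimately have "(sqrt (p x) - sqrt (q x))\<^sup>2 \<le> p x + q x" by linarith
    then show "norm ((sqrt (p x) - sqrt (q x))\<^sup>2) \<le> norm (p x + q x)" using x by simp
  qed
qed (use p q in simp)

text \<open>
  The factor 2 comes from \<open>(a + b)\<^sup>2 \<le> 2 a\<^sup>2 + 2 b\<^sup>2\<close>; it only affects the constant of the risk bound.
\<close>

lemma hdist_weak_triangle:
  assumes J: "J \<in> sets borel" and t: "t \<in> L1plus J" and u: "u \<in> L1plus J" and v: "v \<in> L1plus J"
  shows "hdist J t v \<le> 2 * max (hdist J t u) (hdist J u v)"
proof -
  have sq: "(hdist J p q)\<^sup>2 = (\<integral>x. (sqrt (p x) - sqrt (q x))\<^sup>2 \<partial>leb_on J) / 2"
    and int: "integrable (leb_on J) (\<lambda>x. (sqrt (p x) - sqrt (q x))\<^sup>2)"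
    if p: "p \<in> L1plus J" and q: "q \<in> L1plus J" for p q
  proof -
    show "(hdist J p q)\<^sup>2 = (\<integral>x. (sqrt (p x) - sqrt (q x))\<^sup>2 \<partial>leb_on J) / 2"
      by (simp add: hdist_eq[OF J p q] integral_nonneg_AE)
    show "integrable (leb_on J) (\<lambda>x. (sqrt (p x) - sqrt (q x))\<^sup>2)"
      using p q by (intro integrable_sqrt_diff) (auto simp: L1plus_def space_leb_on)
  qed
  have "(hdist J t v)\<^sup>2 \<le> (\<integral>x. 2 * (sqrt (t x) - sqrt (u x))\<^sup>2 + 2 * (sqrt (u x) - sqrt (v x))\<^sup>2 \<partial>leb_on J) / 2"
    unfolding sq[OF t v]
  proof (intro divide_right_mono integral_mono)
    fix x
    show "(sqrt (t x) - sqrt (v x))\<^sup>2 \<le> 2 * (sqrt (t x) - sqrt (u x))\<^sup>2 + 2 * (sqrt (u x) - sqrt (v x))\<^sup>2"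
      using add_square_le[of "sqrt (t x) - sqrt (u x)" "sqrt (u x) - sqrt (v x)"] by simp
  qed (use int[OF t v] int[OF t u] int[OF u v] in auto)
  also have "\<dots> = 2 * (hdist J t u)\<^sup>2 + 2 * (hdist J u v)\<^sup>2"
    using int[OF t u] int[OF u v] by (simp add: sq[OF t u] sq[OF u v])
  also have "\<dots> \<le> (2 * max (hdist J t u) (hdist J u v))\<^sup>2"
  proof -
    have "(hdist J t u)\<^sup>2 \<le> (max (hdist J t u) (hdist J u v))\<^sup>2" "(hdist J u v)\<^sup>2 \<le> (max (hdist J t u) (hdist J u v))\<^sup>2"
      by (intro power_mono hdist_nonneg; simp)+
    then show ?thesis by (simp add: power_mult_distrib)
  qed
  finally show ?thesis
    by (rule power2_le_imp_le) (simp add: hdist_nonneg le_max_iff_disj)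
qed

section \<open>Robust tests between two intensities\<close>

text \<open>
  Here \<open>w\<^sup>2\<close>, \<open>f\<^sup>2\<close> and \<open>g\<^sup>2\<close> stand for the densities of \<open>\<mu>\<close>, \<open>\<mu>\<^sub>t\<close> and \<open>\<mu>\<^sub>u\<close>. Put \<open>a = (3 f + g) / 4\<close> and
  \<open>b = (f + 3 g) / 4\<close>, so that \<open>r a = b\<close>, and expand \<open>w\<^sup>2\<close> around \<open>a\<close>. The only term that is not a
  polynomial is \<open>(r - 1) (w - a)\<^sup>2\<close>, and \<open>r \<le> 3\<close> bounds it by \<open>2 (w - a)\<^sup>2\<close>. What remains on the left
  is then equal to the right hand side.
\<close>

lemma ratio_test_pointwise:
  fixes w f g r :: real
  assumes "r \<le> 3" and r: "r * (3 * f + g) = f + 3 * g"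
  shows "w\<^sup>2 * (r - 1) - (g\<^sup>2 - f\<^sup>2) / 4 \<le> 2 * (w - f)\<^sup>2 - (f - g)\<^sup>2 / 4"
proof -
  define a where "a = (3 * f + g) / 4"
  have ra: "(r - 1) * a = (g - f) / 2"
    using r by (simp add: a_def field_simps)
  have "w\<^sup>2 * (r - 1) = ((r - 1) * a) * a + 2 * ((r - 1) * a) * (w - a) + (r - 1) * (w - a)\<^sup>2"
    by (simp add: power2_eq_square algebra_simps)
  also have "\<dots> \<le> (g - f) / 2 * a + 2 * ((g - f) / 2) * (w - a) + 2 * (w - a)\<^sup>2"
    unfolding ra using assms(1) by (intro add_left_mono mult_right_mono) auto
  also have "\<dots> = 2 * (w - f)\<^sup>2 - (f - g)\<^sup>2 / 4 + (g\<^sup>2 - f\<^sup>2) / 4"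
    by (simp add: a_def power2_eq_square field_simps)
  finally show ?thesis by simp
qed

text \<open>
  The quotient of the points at three quarters and at one quarter of the segment from \<open>\<surd>t\<close> to \<open>\<surd>u\<close>.
  The absolute values make \<open>like_ratio u t = 1 / like_ratio t u\<close> hold also outside \<open>J\<close>, where the
  intensities can be negative, so that there is one test for each unordered pair.
\<close>

definition like_ratio :: "(real \<Rightarrow> real) \<Rightarrow> (real \<Rightarrow> real) \<Rightarrow> real \<Rightarrow> real" where
  "like_ratio t u x =
     (let f = sqrt \<bar>t x\<bar>; g = sqrt \<bar>u x\<bar> in if f = 0 \<and> g = 0 then 1 else (f + 3 * g) / (3 * f + g))"

lemma like_ratio_bounds:
  shows "1 / 3 \<le> like_ratio t u x" "like_ratio t u x \<le> 3" "0 < like_ratio t u x"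
    "like_ratio t u x * (3 * sqrt \<bar>t x\<bar> + sqrt \<bar>u x\<bar>) = sqrt \<bar>t x\<bar> + 3 * sqrt \<bar>u x\<bar>"
proof -
  define f g where "f = sqrt \<bar>t x\<bar>" and "g = sqrt \<bar>u x\<bar>"
  have nn: "0 \<le> f" "0 \<le> g" by (auto simp: f_def g_def)
  have *: "1 / 3 \<le> like_ratio t u x \<and> like_ratio t u x \<le> 3 \<and> like_ratio t u x * (3 * f + g) = f + 3 * g"
  proof (cases "f = 0 \<and> g = 0")
    case True
    then show ?thesis by (simp add: like_ratio_def f_def g_def)
  next
    case False
    then have pos: "0 < 3 * f + g" using nn by linarith
    have eq: "like_ratio t u x = (f + 3 * g) / (3 * f + g)"
      using False unfolding like_ratio_def Let_def f_def g_def by (simp only: if_False)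
    show ?thesis
      unfolding eq using pos nn by (simp add: pos_le_divide_eq pos_divide_le_eq less_imp_neq[THEN not_sym])
  qed
  then show "1 / 3 \<le> like_ratio t u x" "like_ratio t u x \<le> 3"
    "like_ratio t u x * (3 * sqrt \<bar>t x\<bar> + sqrt \<bar>u x\<bar>) = sqrt \<bar>t x\<bar> + 3 * sqrt \<bar>u x\<bar>"
    by (auto simp: f_def g_def)
  show "0 < like_ratio t u x" using * by linarith
qed

lemma like_ratio_swap: "like_ratio u t x = 1 / like_ratio t u x"
  by (auto simp: like_ratio_def Let_def add.commute)

lemma measurable_like_ratio [measurable]:
  assumes [measurable]: "t \<in> borel_measurable M" "u \<in> borel_measurable M"
  shows "like_ratio t u \<in> borel_measurable M"
  unfolding like_ratio_def[abs_def] Let_def by measurable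

text \<open>
  The pointwise inequality integrated over a measure that dominates both \<open>\<mu>\<close> and Lebesgue measure
  on \<open>J\<close>.
\<close>

lemma ratio_test_exponent:
  assumes J: "finite_measure (leb_on J)" and t: "t \<in> L1plus J" and u: "u \<in> L1plus J"
    and \<mu>: "finite_measure \<mu>" "sets \<mu> = sets (leb_on J)"
  shows "integrable \<mu> (like_ratio t u)"
    and "(\<integral>x. like_ratio t u x - 1 \<partial>\<mu>) - ((\<integral>x. u x \<partial>leb_on J) - (\<integral>x. t x \<partial>leb_on J)) / 4
           \<le> 4 * (hellinger \<mu> (mean_measure J t))\<^sup>2 - (hdist J t u)\<^sup>2 / 2"
proof -
  note spJ = space_leb_on[of J]
  have sp\<mu>: "space \<mu> = J" using sets_eq_imp_space_eq[OF \<mu>(2)] spJ by simp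
  have [measurable]: "t \<in> borel_measurable (leb_on J)" "u \<in> borel_measurable (leb_on J)"
    using t u by (auto simp: L1plus_def)
  have tu0: "0 \<le> t x" "0 \<le> u x" if "x \<in> J" for x
    using t u that by (auto simp: L1plus_def)
  interpret \<mu>: finite_measure \<mu> by fact
  have meas\<mu>: "like_ratio t u \<in> borel_measurable \<mu>"
    by (subst measurable_cong_sets[OF \<mu>(2) refl]) measurable
  show int_r: "integrable \<mu> (like_ratio t u)"
  proof (rule \<mu>.integrable_const_bound[where B = 3])
    show "AE x in \<mu>. norm (like_ratio t u x) \<le> 3"
      using like_ratio_bounds(2,3)[of t u] by (intro AE_I2) (simp add: abs_of_pos)
  qed (rule meas\<mu>)
  obtain \<nu> :: "real measure" and m l where
    \<nu>: "finite_measure \<nu>" "sets \<nu> = sets (leb_on J)" and m0: "\<And>x. 0 \<le> m x" and l0: "\<And>x. 0 \<le> l x"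
    and im: "integrable \<nu> m" and il: "integrable \<nu> l"
    and dm: "density \<nu> (\<lambda>x. ennreal (m x)) = \<mu>" and dl: "density \<nu> (\<lambda>x. ennreal (l x)) = leb_on J"
    using ex_common_densities[OF \<mu>(1) J \<mu>(2)] by metis
  have sp\<nu>: "space \<nu> = J" using sets_eq_imp_space_eq[OF \<nu>(2)] spJ by simp
  have [measurable]: "m \<in> borel_measurable \<nu>" "l \<in> borel_measurable \<nu>" using im il by auto
  have tm\<nu>: "h \<in> borel_measurable \<nu>" if "h \<in> borel_measurable (leb_on J)" for h :: "real \<Rightarrow> real"
    by (subst measurable_cong_sets[OF \<nu>(2) refl]) (rule that)
  have [measurable]: "t \<in> borel_measurable \<nu>" "u \<in> borel_measurable \<nu>"
    by (auto intro!: tm\<nu>)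
  have sf: "sigma_finite_measure \<nu>"
    using \<nu>(1) by (simp add: finite_measure_def)
  have int_l: "integrable \<nu> (\<lambda>x. l x * h x)" "(\<integral>x. h x \<partial>leb_on J) = (\<integral>x. l x * h x \<partial>\<nu>)"
    if h: "h \<in> L1plus J" for h
  proof -
    have [measurable]: "h \<in> borel_measurable \<nu>" using h by (intro tm\<nu>) (auto simp: L1plus_def)
    have "integrable (density \<nu> (\<lambda>x. ennreal (l x))) h" using h dl by (simp add: L1plus_def)
    then show "integrable \<nu> (\<lambda>x. l x * h x)"
      using l0 by (simp add: integrable_density)
    show "(\<integral>x. h x \<partial>leb_on J) = (\<integral>x. l x * h x \<partial>\<nu>)"
      unfolding dl[symmetric] using l0 by (simp add: integral_density)
  qed
  have mm: "mean_measure J h = density \<nu> (\<lambda>x. ennreal (l x * h x))" if h: "h \<in> L1plus J" for h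
  proof -
    have [measurable]: "h \<in> borel_measurable \<nu>" using h by (intro tm\<nu>) (auto simp: L1plus_def)
    have "mean_measure J h = density \<nu> (\<lambda>x. ennreal (l x) * ennreal (h x))"
      unfolding mean_measure_def dl[symmetric] by (rule density_density_eq) auto
    also have "\<dots> = density \<nu> (\<lambda>x. ennreal (l x * h x))"
      by (simp add: ennreal_mult' l0)
    finally show ?thesis .
  qed
  have nn: "0 \<le> l x * h x" if "h \<in> L1plus J" "x \<in> space \<nu>" for h x
    using that l0 sp\<nu> by (auto simp: L1plus_def)
  let ?w = "\<lambda>x. sqrt (m x)" and ?f = "\<lambda>x. sqrt (l x * t x)" and ?g = "\<lambda>x. sqrt (l x * u x)"
  have H1: "(hellinger \<mu> (mean_measure J t))\<^sup>2 = (\<integral>x. (?w x - ?f x)\<^sup>2 \<partial>\<nu>) / 2"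
    unfolding mm[OF t] dm[symmetric]
    by (subst hellinger_density[OF sf im m0 int_l(1)[OF t] nn[OF t]]) (auto intro!: integral_nonneg_AE)
  have H2: "(hdist J t u)\<^sup>2 = (\<integral>x. (?f x - ?g x)\<^sup>2 \<partial>\<nu>) / 2"
    unfolding hdist_def mm[OF t] mm[OF u]
    by (subst hellinger_density[OF sf int_l(1)[OF t] nn[OF t] int_l(1)[OF u] nn[OF u]])
      (auto intro!: integral_nonneg_AE)
  have rm: "integrable \<nu> (\<lambda>x. m x * (like_ratio t u x - 1))"
    and rm_eq: "(\<integral>x. like_ratio t u x - 1 \<partial>\<mu>) = (\<integral>x. m x * (like_ratio t u x - 1) \<partial>\<nu>)"
  proof -
    have "integrable (density \<nu> (\<lambda>x. ennreal (m x))) (\<lambda>x. like_ratio t u x - 1)"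
      using int_r dm by simp
    then show "integrable \<nu> (\<lambda>x. m x * (like_ratio t u x - 1))"
      using m0 by (subst (asm) integrable_density) auto
    show "(\<integral>x. like_ratio t u x - 1 \<partial>\<mu>) = (\<integral>x. m x * (like_ratio t u x - 1) \<partial>\<nu>)"
      unfolding dm[symmetric] using m0 by (subst integral_density) auto
  qed
  have int_wf: "integrable \<nu> (\<lambda>x. (?w x - ?f x)\<^sup>2)" and int_fg: "integrable \<nu> (\<lambda>x. (?f x - ?g x)\<^sup>2)"
    using im int_l(1)[OF t] int_l(1)[OF u] m0 nn[OF t] nn[OF u] sp\<nu> by (auto intro!: integrable_sqrt_diff)
  have "(\<integral>x. like_ratio t u x - 1 \<partial>\<mu>) - ((\<integral>x. u x \<partial>leb_on J) - (\<integral>x. t x \<partial>leb_on J)) / 4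
      = (\<integral>x. m x * (like_ratio t u x - 1) - (l x * u x - l x * t x) / 4 \<partial>\<nu>)"
    using rm int_l[OF t] int_l[OF u] by (simp add: rm_eq)
  also have "\<dots> \<le> (\<integral>x. 2 * (?w x - ?f x)\<^sup>2 - (?f x - ?g x)\<^sup>2 / 4 \<partial>\<nu>)"
  proof (rule integral_mono)
    fix x assume "x \<in> space \<nu>"
    then have x: "0 \<le> t x" "0 \<le> u x" using tu0 sp\<nu> by auto
    have "like_ratio t u x * (3 * ?f x + ?g x) = ?f x + 3 * ?g x"
      using like_ratio_bounds(4)[of t u x] x unfolding real_sqrt_mult abs_of_nonneg[OF x(1)] abs_of_nonneg[OF x(2)]
      by (metis (no_types, lifting) distrib_left mult.left_commute)
    then have "(?w x)\<^sup>2 * (like_ratio t u x - 1) - ((?g x)\<^sup>2 - (?f x)\<^sup>2) / 4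
        \<le> 2 * (?w x - ?f x)\<^sup>2 - (?f x - ?g x)\<^sup>2 / 4"
      using x l0 by (intro ratio_test_pointwise like_ratio_bounds) auto
    then show "m x * (like_ratio t u x - 1) - (l x * u x - l x * t x) / 4
        \<le> 2 * (?w x - ?f x)\<^sup>2 - (?f x - ?g x)\<^sup>2 / 4"
      using x m0[of x] l0[of x] by simp
  qed (use rm int_l(1)[OF t] int_l(1)[OF u] int_wf int_fg in auto)
  also have "\<dots> = 4 * (hellinger \<mu> (mean_measure J t))\<^sup>2 - (hdist J t u)\<^sup>2 / 2"
    using int_wf int_fg by (simp add: H1 H2)
  finally show "(\<integral>x. like_ratio t u x - 1 \<partial>\<mu>) - ((\<integral>x. u x \<partial>leb_on J) - (\<integral>x. t x \<partial>leb_on J)) / 4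
      \<le> 4 * (hellinger \<mu> (mean_measure J t))\<^sup>2 - (hdist J t u)\<^sup>2 / 2" .
qed

text \<open>
  A test compares the sum of the logarithms of the ratios with a quarter of the difference of these costs: the masses
  normalize the likelihoods, and the squared penalties shift the threshold in favour of small
  models.
\<close>

definition cost :: "real set \<Rightarrow> ((real \<Rightarrow> real) \<Rightarrow> real) \<Rightarrow> (real \<Rightarrow> real) \<Rightarrow> real" where
  "cost J e t = (\<integral>x. t x \<partial>leb_on J) + (e t)\<^sup>2"

definition test_stat ::
    "real set \<Rightarrow> ((real \<Rightarrow> real) \<Rightarrow> real) \<Rightarrow> (real \<Rightarrow> real) \<Rightarrow> (real \<Rightarrow> real) \<Rightarrow> real multiset \<Rightarrow> real" where
  "test_stat J e t u X = (\<Sum>x\<in>#X. ln (like_ratio t u x)) - (cost J e u - cost J e t) / 4"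

text \<open>
  Ties are broken by a choice that depends on the set \<open>{t, u}\<close> only.
\<close>

definition ratio_test ::
    "real set \<Rightarrow> ((real \<Rightarrow> real) \<Rightarrow> real) \<Rightarrow> (real \<Rightarrow> real) \<Rightarrow> (real \<Rightarrow> real) \<Rightarrow> real multiset \<Rightarrow> (real \<Rightarrow> real)" where
  "ratio_test J e t u X =
     (if 0 < test_stat J e t u X then u else if test_stat J e t u X < 0 then t else (SOME v. v \<in> {t, u}))"

lemma ratio_test_in: "ratio_test J e t u X \<in> {t, u}"
  using someI_ex[of "\<lambda>v. v \<in> {t, u}"] unfolding ratio_test_def by (smt (verit) insertCI)

lemma test_stat_swap: "test_stat J e u t X = - test_stat J e t u X"
proof -
  have "(\<Sum>x\<in>#X. ln (like_ratio u t x)) = - (\<Sum>x\<in>#X. ln (like_ratio t u x))"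
    by (induction X) (simp_all add: like_ratio_swap[of u t] ln_div like_ratio_bounds less_imp_neq[THEN not_sym])
  then show ?thesis by (simp add: test_stat_def field_simps)
qed

lemma ratio_test_swap: "ratio_test J e t u = ratio_test J e u t"
  using test_stat_swap[of J e u t] by (auto simp: ratio_test_def insert_commute fun_eq_iff)

lemma measurable_test_stat:
  assumes "t \<in> L1plus J" "u \<in> L1plus J"
  shows "test_stat J e t u \<in> borel_measurable (configs (leb_on J))"
proof -
  have [measurable]: "t \<in> borel_measurable (leb_on J)" "u \<in> borel_measurable (leb_on J)"
    using assms by (auto simp: L1plus_def)
  have [measurable]: "(\<lambda>X. \<Sum>x\<in>#X. ln (like_ratio t u x)) \<in> borel_measurable (configs (leb_on J))"
    by (rule measurable_sum_mset_configs) measurable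
  show ?thesis unfolding test_stat_def[abs_def] by measurable
qed

text \<open>
  Both kinds of error are instances of this bound because exchanging the candidates changes the
  sign of the statistic.
\<close>

lemma test_stat_tail:
  assumes J: "finite_measure (leb_on J)" and t: "t \<in> L1plus J" and u: "u \<in> L1plus J"
    and \<mu>: "finite_measure \<mu>" "sets \<mu> = sets (leb_on J)"
    and A: "\<And>X. X \<in> A \<Longrightarrow> 0 \<le> test_stat J e t u X"
  shows "\<P>(X in poisson_process \<mu>. X \<in> A)
    \<le> exp (4 * (hellinger \<mu> (mean_measure J t))\<^sup>2 - (hdist J t u)\<^sup>2 / 2 + ((e t)\<^sup>2 - (e u)\<^sup>2) / 4)"
proof -
  have [measurable]: "t \<in> borel_measurable (leb_on J)" "u \<in> borel_measurable (leb_on J)"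
    using t u by (auto simp: L1plus_def)
  have exp_ln: "exp (ln (like_ratio t u x)) = like_ratio t u x" for x
    by (simp add: like_ratio_bounds)
  have m: "(\<lambda>x. ln (like_ratio t u x)) \<in> borel_measurable \<mu>"
    by (subst measurable_cong_sets[OF \<mu>(2) refl]) measurable
  have "\<P>(X in poisson_process \<mu>. X \<in> A)
      \<le> exp ((\<integral>x. exp (ln (like_ratio t u x)) - 1 \<partial>\<mu>) - (cost J e u - cost J e t) / 4)"
    using A ratio_test_exponent(1)[OF J t u \<mu>]
    by (intro poisson_process_tail_bound[OF \<mu>(1) m]) (auto simp: exp_ln test_stat_def)
  also have "\<dots> \<le> exp (4 * (hellinger \<mu> (mean_measure J t))\<^sup>2 - (hdist J t u)\<^sup>2 / 2 + ((e t)\<^sup>2 - (e u)\<^sup>2) / 4)"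
    using ratio_test_exponent(2)[OF J t u \<mu>] by (simp add: exp_ln cost_def field_simps)
  finally show ?thesis .
qed

lemma test_family_ratio_test:
  assumes "J \<in> sets borel" and J: "finite_measure (leb_on J)" and S: "S \<subseteq> L1plus J"
  shows "test_family J S e (ratio_test J e)"
  unfolding test_family_def
proof (intro ballI impI conjI allI)
  fix t u assume "t \<in> S" "u \<in> S" and ne: "t \<noteq> u"
  then have t: "t \<in> L1plus J" and u: "u \<in> L1plus J" using S by auto
  show "ratio_test J e t u = ratio_test J e u t" by (rule ratio_test_swap)
  have [measurable]: "test_stat J e t u \<in> borel_measurable (configs (leb_on J))"
    using t u by (rule measurable_test_stat)
  have "{X \<in> space (configs (leb_on J)). ratio_test J e t u X = v} \<in> sets (configs (leb_on J))" for v
    unfolding ratio_test_def by measurable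
  then show "ratio_test J e t u \<in> measurable (configs (leb_on J)) (count_space {t, u})"
    using ratio_test_in by (subst measurable_count_space_eq2) (auto simp: vimage_def Int_def conj_commute)
  fix \<mu> assume "finite_measure \<mu> \<and> sets \<mu> = sets (leb_on J)"
  then have \<mu>: "finite_measure \<mu>" "sets \<mu> = sets (leb_on J)" by auto
  have key: "\<P>(X in poisson_process \<mu>. ratio_test J e t' u' X = u')
      \<le> exp (4 * (hellinger \<mu> (mean_measure J t'))\<^sup>2 - (hdist J t' u')\<^sup>2 / 2 + ((e t')\<^sup>2 - (e u')\<^sup>2) / 4)"
    if "t' \<in> L1plus J" "u' \<in> L1plus J" "t' \<noteq> u'" for t' u'
    using test_stat_tail[OF J that(1,2) \<mu>, of "{X. ratio_test J e t' u' X = u'}" e] that(3)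
    by (force simp: ratio_test_def split: if_splits)
  have near: "4 * h\<^sup>2 - d\<^sup>2 / 2 + (a - b) / 4 \<le> - (d\<^sup>2 - a + b) / 4"
    if "h \<le> d / 4" "0 \<le> h" for h d a b :: real
  proof -
    have "h\<^sup>2 \<le> (d / 4)\<^sup>2" using that by (intro power_mono)
    then show ?thesis by (simp add: power_divide field_simps)
  qed
  show "\<P>(X in poisson_process \<mu>. ratio_test J e t u X = u)
      \<le> exp (- ((hdist J t u)\<^sup>2 - (e t)\<^sup>2 + (e u)\<^sup>2) / 4)"
    if "hellinger \<mu> (mean_measure J t) \<le> hdist J t u / 4"
    using key[OF t u ne] near[OF that hellinger_nonneg] by (meson exp_le_cancel_iff order_trans)
  have comm: "hdist J u t = hdist J t u"
    using assms(1) t u by (intro hdist_commute)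
  show "\<P>(X in poisson_process \<mu>. ratio_test J e t u X = t)
      \<le> exp (- ((hdist J t u)\<^sup>2 - (e u)\<^sup>2 + (e t)\<^sup>2) / 4)"
    if "hellinger \<mu> (mean_measure J u) \<le> hdist J t u / 4"
    using key[OF u t ne[symmetric]] near[OF that hellinger_nonneg, of "(e u)\<^sup>2" "(e t)\<^sup>2"] 
    unfolding ratio_test_swap[of J e u t] comm by (meson exp_le_cancel_iff order_trans)
  have "4 * (hellinger \<mu> (mean_measure J t))\<^sup>2 - (hdist J t u)\<^sup>2 / 2 + ((e t)\<^sup>2 - (e u)\<^sup>2) / 4
      \<le> (16 * (hellinger \<mu> (mean_measure J t))\<^sup>2 + (e t)\<^sup>2 - (e u)\<^sup>2) / 4"
    by (simp add: field_simps)
  then show "\<P>(X in poisson_process \<mu>. ratio_test J e t u X = u)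
      \<le> exp ((16 * (hellinger \<mu> (mean_measure J t))\<^sup>2 + (e t)\<^sup>2 - (e u)\<^sup>2) / 4)"
    using key[OF t u ne] by (meson exp_le_cancel_iff order_trans)
qed

text \<open>
  Each point changes the test statistic by at most \<open>ln 3\<close>, so for a given configuration a much
  cheaper candidate always wins.
\<close>

lemma ratio_test_cheaper:
  assumes "cost J e t + 4 * real (size X) * ln 3 < cost J e u"
  shows "ratio_test J e t u X = t"
proof -
  have "(\<Sum>x\<in>#X. ln (like_ratio t u x)) \<le> real (size X) * ln 3"
  proof (induction X)
    case (add x X)
    have "ln (like_ratio t u x) \<le> ln 3"
      using like_ratio_bounds[of t u x] by (subst ln_le_cancel_iff) auto
    then show ?case using add by (simp add: algebra_simps)
  qed simp
  then show ?thesis using assms by (simp add: ratio_test_def test_stat_def)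
qed

section \<open>T-estimators\<close>

lemma le_T_criterion:
  assumes "u \<in> S" "u \<noteq> t" "\<psi> t u X = u"
  shows "ennreal (hdist J t u) \<le> T_criterion J S \<psi> X t"
  unfolding T_criterion_def using assms by (intro SUP_upper) auto

lemma test_family_error:
  assumes "test_family J S e \<psi>" "t \<in> S" "u \<in> S" "t \<noteq> u"
    and "finite_measure \<mu>" "sets \<mu> = sets (leb_on J)"
    and "hellinger \<mu> (mean_measure J t) \<le> hdist J t u / 4"
  shows "\<P>(X in poisson_process \<mu>. \<psi> t u X = u) \<le> exp (- ((hdist J t u)\<^sup>2 - (e t)\<^sup>2 + (e u)\<^sup>2) / 4)"
  using assms(1)[unfolded test_family_def, rule_format, OF assms(2-4)] assms(5-) by blast

lemma measurable_T_criterion: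
  assumes S: "countable S" and \<psi>: "test_family J S e \<psi>" and t: "t \<in> S"
  shows "(\<lambda>X. T_criterion J S \<psi> X t) \<in> borel_measurable (configs (leb_on J))"
proof -
  have eq: "T_criterion J S \<psi> X t = (SUP u\<in>S - {t}. if \<psi> t u X = u then ennreal (hdist J t u) else 0)" for X
    unfolding T_criterion_def
  proof (intro antisym SUP_least)
    fix u assume "u \<in> {u \<in> S. u \<noteq> t \<and> \<psi> t u X = u}"
    then show "ennreal (hdist J t u) \<le> (SUP u\<in>S - {t}. if \<psi> t u X = u then ennreal (hdist J t u) else 0)"
      by (intro SUP_upper2[of u]) auto
  next
    fix u assume "u \<in> S - {t}"
    then show "(if \<psi> t u X = u then ennreal (hdist J t u) else 0)
        \<le> (SUP u\<in>{u \<in> S. u \<noteq> t \<and> \<psi> t u X = u}. ennreal (hdist J t u))"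
      by (auto intro: SUP_upper)
  qed
  have "(\<lambda>X. if \<psi> t u X = u then ennreal (hdist J t u) else 0) \<in> borel_measurable (configs (leb_on J))"
    if u: "u \<in> S - {t}" for u
  proof -
    have [measurable]: "\<psi> t u \<in> measurable (configs (leb_on J)) (count_space {t, u})"
      using \<psi> t u by (auto simp: test_family_def)
    have [measurable]: "{u} \<in> sets (count_space {t, u})" by simp
    have "Measurable.pred (configs (leb_on J)) (\<lambda>X. \<psi> t u X \<in> {u})" by measurable
    then have [measurable]: "Measurable.pred (configs (leb_on J)) (\<lambda>X. \<psi> t u X = u)" by simp
    show ?thesis by measurable
  qed
  then show ?thesis unfolding eq using S by (intro borel_measurable_SUP) auto
qed

text \<open>
  Enumerate the candidates and take the first minimizer in that enumeration.
\<close>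

lemma ex_measurable_minimizer:
  assumes S: "countable S" and \<psi>: "test_family J S e \<psi>"
    and ex: "\<And>X. X \<in> space (configs (leb_on J)) \<Longrightarrow> \<exists>t\<in>S. \<forall>u\<in>S. T_criterion J S \<psi> X t \<le> T_criterion J S \<psi> X u"
  obtains est where "est \<in> measurable (configs (leb_on J)) (count_space S)"
    and "\<And>X u. X \<in> space (configs (leb_on J)) \<Longrightarrow> u \<in> S \<Longrightarrow> T_criterion J S \<psi> X (est X) \<le> T_criterion J S \<psi> X u"
proof -
  have "S \<noteq> {}" using ex[of "{#}"] by (auto simp: space_configs)
  define s where "s = from_nat_into S"
  have s: "range s = S" unfolding s_def by (rule range_from_nat_into[OF \<open>S \<noteq> {}\<close> S])
  let ?crit = "\<lambda>X t. T_criterion J S \<psi> X t"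
  define best where "best X = (LEAST n. \<forall>k. ?crit X (s n) \<le> ?crit X (s k))" for X
  have [measurable]: "(\<lambda>X. ?crit X (s n)) \<in> borel_measurable (configs (leb_on J))" for n
    using s by (intro measurable_T_criterion[OF S \<psi>]) auto
  have "best \<in> measurable (configs (leb_on J)) (count_space UNIV)"
    unfolding best_def[abs_def] by measurable
  moreover have "s \<in> measurable (count_space UNIV) (count_space S)" using s by auto
  ultimately have "(\<lambda>X. s (best X)) \<in> measurable (configs (leb_on J)) (count_space S)"
    by (rule measurable_compose)
  moreover have "?crit X (s (best X)) \<le> ?crit X u" if X: "X \<in> space (configs (leb_on J))" and u: "u \<in> S" for X u
  proof -
    obtain n where "\<forall>k. ?crit X (s n) \<le> ?crit X (s k)" using ex[OF X] s by (metis rangeE rangeI)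
    then have "\<forall>k. ?crit X (s (best X)) \<le> ?crit X (s k)" unfolding best_def by (rule LeastI)
    then show ?thesis using u s by auto
  qed
  ultimately show ?thesis by (rule that)
qed

text \<open>
  For a given configuration, all but finitely many candidates \<open>t\<close> cost so much that both \<open>z\<close> and a
  candidate \<open>v\<close> far away from \<open>z\<close> beat them. One of \<open>z\<close> and \<open>v\<close> is far from \<open>t\<close>, hence the criterion
  at \<open>t\<close> exceeds its value at \<open>z\<close>, and a minimizer over the remaining finite set is a minimizer over
  \<open>S\<close>.
\<close>

lemma ex_T_criterion_minimizer:
  assumes J: "J \<in> sets borel" and S: "S \<subseteq> L1plus J"
    and fin: "\<And>K. finite {t \<in> S. cost J e t \<le> K}"
    and z: "z \<in> S" and unbounded: "\<And>R. \<exists>u\<in>S. R < hdist J z u"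
  shows "\<exists>t\<in>S. \<forall>u\<in>S. T_criterion J S (ratio_test J e) X t \<le> T_criterion J S (ratio_test J e) X u"
proof -
  let ?crit = "T_criterion J S (ratio_test J e) X"
  \<comment> \<open>A candidate loses against every other one that is cheaper by more than \<open>b\<close>.\<close>
  define b where "b = 4 * real (size X) * ln 3"
  have b: "0 \<le> b" by (simp add: b_def)
  let ?W = "{u \<in> S. cost J e u \<le> cost J e z + b}"
  obtain R where R: "\<And>u. u \<in> ?W \<Longrightarrow> hdist J z u \<le> R" "0 \<le> R"
  proof -
    have "bdd_above (insert 0 (hdist J z ` ?W))" using fin by (intro bdd_above_finite) auto
    then obtain R where "\<And>y. y \<in> insert 0 (hdist J z ` ?W) \<Longrightarrow> y \<le> R" by (auto simp: bdd_above_def)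
    then show ?thesis using that[of R] by auto
  qed
  have crit_z: "?crit z \<le> ennreal R"
    unfolding T_criterion_def
  proof (rule SUP_least)
    fix u assume u: "u \<in> {u \<in> S. u \<noteq> z \<and> ratio_test J e z u X = u}"
    then have "cost J e u \<le> cost J e z + b"
      using ratio_test_cheaper[of J e z X u] by (fastforce simp: b_def)
    then show "ennreal (hdist J z u) \<le> ennreal R" using u R by (intro ennreal_leI) auto
  qed
  obtain v where v: "v \<in> S" "2 * R < hdist J z v" using unbounded[of "2 * R"] by auto
  define F where "F = {t \<in> S. cost J e t \<le> max (cost J e z) (cost J e v) + b}"
  have F: "finite F" "z \<in> F" unfolding F_def using fin z b by auto
  have outside: "ennreal R \<le> ?crit t" if t: "t \<in> S - F" for t
  proof -
    have "t \<in> L1plus J" "z \<in> L1plus J" "v \<in> L1plus J" using t z v S by auto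
    then have "2 * R < 2 * max (hdist J t z) (hdist J t v)"
      using hdist_weak_triangle[OF J, of z t v] hdist_commute[OF J, of z t] v(2) by linarith
    then obtain w where w: "w \<in> {z, v}" "R < hdist J t w" by (auto simp: less_max_iff_disj)
    have "z \<in> F" "v \<in> F" using z v(1) b by (auto simp: F_def)
    then have "w \<in> S" "w \<noteq> t" using w t v(1) z by auto
    moreover have "ratio_test J e t w X = w"
      using ratio_test_cheaper[of J e w X t] t w(1) ratio_test_swap[of J e t w] by (auto simp: F_def b_def max_def split: if_splits)
    ultimately have "ennreal (hdist J t w) \<le> ?crit t" by (intro le_T_criterion)
    then show ?thesis using w(2) by (meson ennreal_leI less_imp_le order_trans)
  qed
  obtain t where t: "t \<in> F" "\<And>u. u \<in> F \<Longrightarrow> ?crit t \<le> ?crit u"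
    using F by (metis arg_min_if_finite(1) arg_min_least empty_iff)
  have "?crit t \<le> ?crit u" if "u \<in> S" for u
    using t(2)[of u] t(2)[OF F(2)] crit_z outside[of u] that by (cases "u \<in> F") (auto intro: order_trans)
  then show ?thesis using t(1) by (auto simp: F_def)
qed

text \<open>
  This absorbs the power of the distance in the risk into a small part of the Gaussian error
  bound. The constant depends on \<open>q\<close> only.
\<close>

lemma powr_le_exp_square:
  fixes q :: real
  assumes "1 \<le> q"
  obtains C :: real where "0 < C" and "\<And>x. 0 \<le> x \<Longrightarrow> x powr q \<le> C * exp (x\<^sup>2 / 16)"
proof -
  define n where "n = nat \<lceil>q\<rceil>"
  have qn: "q \<le> real n" using assms by (simp add: n_def)
  define C :: real where "C = 1 + 16 ^ n * fact n"
  have "x powr q \<le> C * exp (x\<^sup>2 / 16)" if x: "0 \<le> x" for x :: real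
  proof (cases "x \<le> 1")
    case True
    then have "x powr q \<le> 1" using x assms by (intro powr_le1) auto
    also have "\<dots> \<le> C * exp (x\<^sup>2 / 16)"
      using mult_mono[of 1 C 1 "exp (x\<^sup>2 / 16)"] by (simp add: C_def)
    finally show ?thesis .
  next
    case False
    define y where "y = x\<^sup>2 / 16"
    have "(\<lambda>k. y ^ k / fact k) sums exp y"
      using exp_converges[of y] by (simp add: field_simps)
    then have "(\<Sum>k\<in>{n}. y ^ k / fact k) \<le> exp y" using sum_le_suminf[of "\<lambda>k. y ^ k / fact k" "{n}"]
      by (auto simp: y_def sums_iff)
    then have exp_y: "y ^ n \<le> fact n * exp y" by (simp add: field_simps)
    have "x powr q \<le> x powr real n" using False qn by (intro powr_mono) auto
    also have "\<dots> = x ^ n" using False by (simp add: powr_realpow)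
    also have "\<dots> \<le> (x\<^sup>2) ^ n" using False self_le_power[of x 2] by (intro power_mono) auto
    also have "\<dots> = 16 ^ n * y ^ n" by (simp add: y_def power_divide)
    also have "\<dots> \<le> 16 ^ n * (fact n * exp y)" using exp_y by (intro mult_left_mono) auto
    also have "\<dots> \<le> C * exp y" by (simp add: C_def algebra_simps)
    finally show ?thesis by (simp add: y_def)
  qed
  moreover have "0 < C" by (simp add: C_def add_pos_pos)
  ultimately show ?thesis by (rule that[rotated])
qed

lemma borel_measurable_nn_integral_count_space:
  fixes f :: "'i \<Rightarrow> 'a \<Rightarrow> ennreal"
  assumes "countable I" and f: "\<And>i. i \<in> I \<Longrightarrow> f i \<in> borel_measurable M"
  shows "(\<lambda>x. \<integral>\<^sup>+i. f i x \<partial>count_space I) \<in> borel_measurable M"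
proof (cases "finite I")
  case True
  then show ?thesis using f by (simp add: nn_integral_count_space_finite)
next
  case False
  then have "(\<integral>\<^sup>+i. f i x \<partial>count_space I) = (\<Sum>n. f (from_nat_into I n) x)" for x
    using nn_integral_bij_count_space[OF bij_betw_from_nat_into[OF assms(1) False], of "\<lambda>i. f i x"]
    by (simp add: nn_integral_count_space_nat)
  moreover have "f (from_nat_into I n) \<in> borel_measurable M" for n
    using False by (intro f from_nat_into) auto
  ultimately show ?thesis by simp
qed

text \<open>
  If the estimate \<open>v\<close> differs from \<open>t\<close>, then either \<open>v\<close> beats \<open>t\<close>, or \<open>t\<close> beats \<open>v\<close> and the criterion at
  \<open>v\<close>, which is at most the criterion at \<open>t\<close>, is at least the distance of \<open>t\<close> and \<open>v\<close>. In both cases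
  that distance is at most the supremum of \<open>H(t, u)\<close> over the \<open>u\<close> that beat \<open>t\<close>, whose \<open>q\<close>-th power
  is at most \<open>r\<^sup>q\<close> plus the sum over those \<open>u\<close> with \<open>H(t, u) > r\<close>. For such \<open>u\<close> the two conditions on \<open>r\<close>
  say that the error bound of the test applies, and that its term \<open>\<eta>\<^sup>2(t) / 4\<close> is at most
  \<open>H\<^sup>2(t, u) / 16\<close>.
\<close>

theorem T_estimator_risk:
  assumes J: "J \<in> sets borel" "finite_measure (leb_on J)"
    and S: "countable S" "S \<subseteq> L1plus J" and \<psi>: "test_family J S e \<psi>"
    and est: "\<And>X. X \<in> space (configs (leb_on J)) \<Longrightarrow> est X \<in> S"
    and min: "\<And>X u. X \<in> space (configs (leb_on J)) \<Longrightarrow> u \<in> S \<Longrightarrow> T_criterion J S \<psi> X (est X) \<le> T_criterion J S \<psi> X u"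
    and s: "s \<in> L1plus J" and t: "t \<in> S"
    and r: "4 * hdist J s t \<le> r" "2 * \<bar>e t\<bar> \<le> r" and q: "1 \<le> q"
    and C: "0 \<le> C" "\<And>x. 0 \<le> x \<Longrightarrow> x powr q \<le> C * exp (x\<^sup>2 / 16)"
  shows "(\<integral>\<^sup>+X. ennreal (hdist J s (est X) powr q) \<partial>poisson_process (mean_measure J s))
    \<le> ennreal (2 powr q) * (ennreal (2 * r powr q) + ennreal C *
        (\<integral>\<^sup>+u. ennreal (exp (- (hdist J t u)\<^sup>2 / 8 - (e u)\<^sup>2 / 4)) \<partial>count_space S))"
proof -
  let ?P = "poisson_process (mean_measure J s)"
  have tL: "t \<in> L1plus J" using t S by auto
  have \<mu>: "finite_measure (mean_measure J s)" "sets (mean_measure J s) = sets (leb_on J)"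
    using s by (auto simp: finite_measure_mean_measure) (auto simp: mean_measure_def)
  interpret prob_space ?P by (rule prob_space_poisson_process[OF \<mu>(1)])
  have sets_P: "sets ?P = sets (configs (leb_on J))"
    using sets_poisson_process[OF \<mu>(1)] configs_cong[OF \<mu>(2)] by simp
  note sp = sets_eq_imp_space_eq[OF sets_P]
  have r0: "0 \<le> r" using r(1) hdist_nonneg[of J s t] by linarith
  \<comment> \<open>The event that \<open>u\<close> beats \<open>t\<close> from a distance of more than \<open>r\<close>.\<close>
  define B where "B u = {X \<in> space ?P. u \<noteq> t \<and> r < hdist J t u \<and> \<psi> t u X = u}" for u
  have B_meas: "B u \<in> events" if u: "u \<in> S" for u
  proof (cases "u = t")
    case False
    then have "\<psi> t u \<in> measurable (configs (leb_on J)) (count_space {t, u})"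
      using \<psi> t u by (auto simp: test_family_def)
    then have [measurable]: "\<psi> t u \<in> measurable ?P (count_space {t, u})"
      by (subst measurable_cong_sets[OF sets_P refl])
    have [measurable]: "{u} \<in> sets (count_space {t, u})" by simp
    have "{X \<in> space ?P. \<psi> t u X \<in> {u}} \<in> events" by measurable
    then show ?thesis by (cases "r < hdist J t u") (auto simp: B_def)
  qed (simp add: B_def)
  have term_meas: "(\<lambda>X. ennreal (hdist J t u powr q) * indicator (B u) X) \<in> borel_measurable ?P" if "u \<in> S" for u
    by (intro borel_measurable_times_ennreal borel_measurable_const borel_measurable_indicator B_meas that)
  let ?R = "\<lambda>X. ennreal (r powr q) + (\<integral>\<^sup>+u. ennreal (hdist J t u powr q) * indicator (B u) X \<partial>count_space S)"
  have bound: "ennreal (hdist J t (est X) powr q) \<le> ?R X" if X: "X \<in> space ?P" for X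
  proof (cases "?R X" rule: ennreal_cases)
    case \<rho>: (real \<rho>)
    have X': "X \<in> space (configs (leb_on J))" using X sp by simp
    have beats: "hdist J t u \<le> \<rho> powr (1 / q)" if u: "u \<in> S" "u \<noteq> t" "\<psi> t u X = u" for u
    proof -
      have "ennreal (hdist J t u powr q) \<le> ?R X"
      proof (cases "r < hdist J t u")
        case True
        then have "X \<in> B u" using u X by (simp add: B_def)
        then have "ennreal (hdist J t u powr q)
            \<le> (\<integral>\<^sup>+u. ennreal (hdist J t u powr q) * indicator (B u) X \<partial>count_space S)"
          using nn_integral_ge_point[OF u(1), of "\<lambda>u. ennreal (hdist J t u powr q) * indicator (B u) X"] by simp
        then show ?thesis by (rule order_trans) simp
      next
        case False
        then have "ennreal (hdist J t u powr q) \<le> ennreal (r powr q)"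
          using q hdist_nonneg by (intro ennreal_leI powr_mono2) auto
        then show ?thesis by (rule order_trans) simp
      qed
      then have "hdist J t u powr q \<le> \<rho>" unfolding \<rho>(2) using \<rho>(1) by simp
      then have "(hdist J t u powr q) powr (1 / q) \<le> \<rho> powr (1 / q)"
        using q by (intro powr_mono2) auto
      then show ?thesis using q by (simp add: powr_powr hdist_nonneg)
    qed
    then have crit: "T_criterion J S \<psi> X t \<le> ennreal (\<rho> powr (1 / q))"
      unfolding T_criterion_def by (intro SUP_least ennreal_leI) auto
    have "hdist J t (est X) \<le> \<rho> powr (1 / q)"
    proof (cases "est X = t \<or> \<psi> t (est X) X = est X")
      case True
      moreover have "hdist J t t = 0" using hdist_eq[OF J(1) tL tL] by simp
      ultimately show ?thesis using beats[OF est[OF X']] by fastforce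
    next
      case False
      have "\<psi> t (est X) \<in> measurable (configs (leb_on J)) (count_space {t, est X})"
        and sym: "\<psi> t (est X) = \<psi> (est X) t"
        using False \<psi> t est[OF X'] by (auto simp: test_family_def)
      then have "\<psi> t (est X) X \<in> {t, est X}" using X' by (auto dest: measurable_space)
      then have "ennreal (hdist J (est X) t) \<le> T_criterion J S \<psi> X (est X)"
        using False t sym by (intro le_T_criterion) auto
      also have "\<dots> \<le> T_criterion J S \<psi> X t" by (rule min[OF X' t])
      also note crit
      finally show ?thesis
        using hdist_commute[OF J(1) tL, of "est X"] est[OF X'] S by (auto simp: ennreal_le_iff)
    qed
    then have "hdist J t (est X) powr q \<le> (\<rho> powr (1 / q)) powr q"
      using q hdist_nonneg by (intro powr_mono2) auto
    also have "\<dots> = \<rho>" using q \<rho>(1) by (simp add: powr_powr)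
    finally show ?thesis unfolding \<rho>(2) by (rule ennreal_leI)
  qed (simp only: top_greatest)
  have each: "(\<integral>\<^sup>+X. ennreal (hdist J t u powr q) * indicator (B u) X \<partial>?P)
      \<le> ennreal C * ennreal (exp (- (hdist J t u)\<^sup>2 / 8 - (e u)\<^sup>2 / 4))" if u: "u \<in> S" for u
  proof (cases "u \<noteq> t \<and> r < hdist J t u")
    case True
    let ?h = "hdist J t u"
    have "prob (B u) \<le> exp (- (?h\<^sup>2 - (e t)\<^sup>2 + (e u)\<^sup>2) / 4)"
    proof -
      have "hellinger (mean_measure J s) (mean_measure J t) \<le> ?h / 4"
        using r(1) True by (simp add: hdist_def)
      then have "\<P>(X in ?P. \<psi> t u X = u) \<le> exp (- (?h\<^sup>2 - (e t)\<^sup>2 + (e u)\<^sup>2) / 4)"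
        using test_family_error[OF \<psi> t u _ \<mu>] True by blast
      then show ?thesis using True by (simp add: B_def)
    qed
    then have "?h powr q * prob (B u) \<le> (C * exp (?h\<^sup>2 / 16)) * exp (- (?h\<^sup>2 - (e t)\<^sup>2 + (e u)\<^sup>2) / 4)"
      using C hdist_nonneg by (intro mult_mono) auto
    also have "\<dots> \<le> C * exp (- ?h\<^sup>2 / 8 - (e u)\<^sup>2 / 4)"
    proof -
      have "(2 * \<bar>e t\<bar>)\<^sup>2 \<le> ?h\<^sup>2" using r(2) True by (intro power_mono) auto
      then have "?h\<^sup>2 / 16 + - (?h\<^sup>2 - (e t)\<^sup>2 + (e u)\<^sup>2) / 4 \<le> - ?h\<^sup>2 / 8 - (e u)\<^sup>2 / 4"
        by (simp add: power_mult_distrib field_simps)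
      then show ?thesis using C(1) by (simp add: mult.assoc mult_left_mono flip: exp_add)
    qed
    finally have "ennreal (?h powr q * prob (B u)) \<le> ennreal (C * exp (- ?h\<^sup>2 / 8 - (e u)\<^sup>2 / 4))"
      by (rule ennreal_leI)
    then show ?thesis
      using C(1) B_meas[OF u] by (simp add: nn_integral_cmult emeasure_eq_measure ennreal_mult)
  next
    case False
    then have "B u = {}" by (auto simp: B_def)
    then show ?thesis by simp
  qed
  have "(\<integral>\<^sup>+X. ennreal (hdist J s (est X) powr q) \<partial>?P) \<le> (\<integral>\<^sup>+X. ennreal (2 powr q) * (ennreal (r powr q) + ?R X) \<partial>?P)"
  proof (rule nn_integral_mono)
    fix X assume X: "X \<in> space ?P"
    then have eL: "est X \<in> L1plus J" using est S sp by auto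
    have "hdist J s (est X) powr q \<le> (2 * max (hdist J s t) (hdist J t (est X))) powr q"
      using q hdist_nonneg by (intro powr_mono2 hdist_weak_triangle[OF J(1) s tL eL]) auto
    also have "\<dots> = 2 powr q * max (hdist J s t) (hdist J t (est X)) powr q"
      using hdist_nonneg by (intro powr_mult) 
    also have "\<dots> \<le> 2 powr q * (r powr q + hdist J t (est X) powr q)"
    proof (rule mult_left_mono)
      have "hdist J s t powr q \<le> r powr q"
        using q r(1) hdist_nonneg[of J s t] by (intro powr_mono2) auto
      then show "max (hdist J s t) (hdist J t (est X)) powr q \<le> r powr q + hdist J t (est X) powr q"
        by (auto simp: max_def intro: add_increasing2)
    qed simp
    finally have "ennreal (hdist J s (est X) powr q)
        \<le> ennreal (2 powr q) * (ennreal (r powr q) + ennreal (hdist J t (est X) powr q))"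
      by (simp add: ennreal_leI flip: ennreal_mult ennreal_plus)
    also have "\<dots> \<le> ennreal (2 powr q) * (ennreal (r powr q) + ?R X)"
      using bound[OF X] by (intro mult_left_mono add_left_mono) auto
    finally show "ennreal (hdist J s (est X) powr q) \<le> ennreal (2 powr q) * (ennreal (r powr q) + ?R X)" .
  qed
  also have "\<dots> = ennreal (2 powr q) * (ennreal (2 * r powr q) +
      (\<integral>\<^sup>+X. \<integral>\<^sup>+u. ennreal (hdist J t u powr q) * indicator (B u) X \<partial>count_space S \<partial>?P))"
  proof -
    define G where "G X = (\<integral>\<^sup>+u. ennreal (hdist J t u powr q) * indicator (B u) X \<partial>count_space S)" for X
    have [measurable]: "G \<in> borel_measurable ?P"
      unfolding G_def[abs_def] using term_meas by (rule borel_measurable_nn_integral_count_space[OF S(1)])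
    have "ennreal (2 * r powr q) = ennreal (r powr q) + ennreal (r powr q)"
      by (simp flip: ennreal_plus)
    then show ?thesis
      unfolding G_def[symmetric] by (simp add: nn_integral_cmult nn_integral_add emeasure_space_1 add.assoc)
  qed
  also have "(\<integral>\<^sup>+X. \<integral>\<^sup>+u. ennreal (hdist J t u powr q) * indicator (B u) X \<partial>count_space S \<partial>?P)
      = (\<integral>\<^sup>+u. \<integral>\<^sup>+X. ennreal (hdist J t u powr q) * indicator (B u) X \<partial>?P \<partial>count_space S)"
    by (rule nn_integral_count_space_nn_integral[OF S(1) term_meas])
  finally have total: "(\<integral>\<^sup>+X. ennreal (hdist J s (est X) powr q) \<partial>?P) \<le> ennreal (2 powr q) * (ennreal (2 * r powr q) +
      (\<integral>\<^sup>+u. \<integral>\<^sup>+X. ennreal (hdist J t u powr q) * indicator (B u) X \<partial>?P \<partial>count_space S))" .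
  have "(\<integral>\<^sup>+u. \<integral>\<^sup>+X. ennreal (hdist J t u powr q) * indicator (B u) X \<partial>?P \<partial>count_space S)
      \<le> (\<integral>\<^sup>+u. ennreal C * ennreal (exp (- (hdist J t u)\<^sup>2 / 8 - (e u)\<^sup>2 / 4)) \<partial>count_space S)"
    using each by (intro nn_integral_mono) auto
  also have "\<dots> = ennreal C * (\<integral>\<^sup>+u. ennreal (exp (- (hdist J t u)\<^sup>2 / 8 - (e u)\<^sup>2 / 4)) \<partial>count_space S)"
    by (rule nn_integral_cmult) simp
  finally show ?thesis
    by (intro order_trans[OF total] mult_left_mono add_left_mono) auto
qed

section \<open>Step functions on dyadic trees\<close>

datatype dtree = Leaf nat | Node dtree dtree

primrec leaves :: "dtree \<Rightarrow> nat" where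
  "leaves (Leaf k) = 1"
| "leaves (Node S T) = leaves S + leaves T"

primrec height :: "dtree \<Rightarrow> nat" where
  "height (Leaf k) = 0"
| "height (Node S T) = Suc (max (height S) (height T))"

text \<open>
  The step functions are meant as square roots of intensities. A leaf stands for a multiple of the
  normalized indicator of its cell, so that different values on one cell differ by at least 1 in
  the norm of \<open>L\<^sub>2\<close>, whatever the length of the cell. The cells are half-open, so that the
  functions are continuous from the right.
\<close>

primrec step :: "dtree \<Rightarrow> real \<Rightarrow> real \<Rightarrow> real \<Rightarrow> real" where
  "step (Leaf k) a l x = real k / sqrt l * indicator {a..<a + l} x"
| "step (Node S T) a l x = step S a (l / 2) x + step T (a + l / 2) (l / 2) x"

lemma leaves_pos: "0 < leaves T"
  by (induction T) auto

lemma step_nonneg: "0 \<le> l \<Longrightarrow> 0 \<le> step T a l x"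
  by (induction T arbitrary: a l) auto

lemma step_outside: "0 \<le> l \<Longrightarrow> x \<notin> {a..<a + l} \<Longrightarrow> step T a l x = 0"
  by (induction T arbitrary: a l) (auto simp: indicator_def)

lemma step_measurable [measurable]: "step T a l \<in> borel_measurable borel"
proof (induction T arbitrary: a l)
  case (Leaf k)
  have "step (Leaf k) a l = (\<lambda>x. real k / sqrt l * indicator {a..<a + l} x)" by (simp add: fun_eq_iff)
  then show ?case by simp
next
  case (Node S T)
  have "step (Node S T) a l = (\<lambda>x. step S a (l / 2) x + step T (a + l / 2) (l / 2) x)" by (simp add: fun_eq_iff)
  then show ?case using Node by simp
qed

lemma step_bounded: "\<exists>B. \<forall>x. \<bar>step T a l x\<bar> \<le> B"
proof (induction T arbitrary: a l)
  case (Leaf k)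
  show ?case by (intro exI[of _ "\<bar>real k / sqrt l\<bar>"]) (auto simp: indicator_def)
next
  case (Node S T)
  from Node.IH(1)[of a "l / 2"] obtain B where B: "\<forall>x. \<bar>step S a (l / 2) x\<bar> \<le> B" ..
  from Node.IH(2)[of "a + l / 2" "l / 2"] obtain C where C: "\<forall>x. \<bar>step T (a + l / 2) (l / 2) x\<bar> \<le> C" ..
  have "\<bar>step (Node S T) a l x\<bar> \<le> B + C" for x
    using abs_triangle_ineq[of "step S a (l / 2) x" "step T (a + l / 2) (l / 2) x"] B[rule_format, of x] C[rule_format, of x]
    unfolding step.simps by linarith
  then show ?case by blast
qed

lemma step_right_constant: "0 < l \<Longrightarrow> \<exists>d>0. \<forall>y\<in>{x..<x + d}. step T a l y = step T a l x"
proof (induction T arbitrary: a l)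
  case (Leaf k)
  consider "x < a" | "a \<le> x" "x < a + l" | "a + l \<le> x" by linarith
  then show ?case
  proof cases
    case 1
    then show ?thesis by (intro exI[of _ "a - x"]) auto
  next
    case 2
    then show ?thesis by (intro exI[of _ "a + l - x"]) auto
  next
    case 3
    then show ?thesis by (intro exI[of _ 1]) auto
  qed
next
  case (Node S T)
  have l: "0 < l / 2" using Node.prems by simp
  from Node.IH(1)[OF l, of a] obtain d
    where d: "0 < d" "\<forall>y\<in>{x..<x + d}. step S a (l / 2) y = step S a (l / 2) x" by blast
  from Node.IH(2)[OF l, of "a + l / 2"] obtain e
    where e: "0 < e" "\<forall>y\<in>{x..<x + e}. step T (a + l / 2) (l / 2) y = step T (a + l / 2) (l / 2) x" by blast
  have "step (Node S T) a l y = step (Node S T) a l x" if "y \<in> {x..<x + min d e}" for y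
  proof -
    have "y < x + d" "y < x + e" using that by auto
    then have "y \<in> {x..<x + d}" "y \<in> {x..<x + e}" using that by auto
    then show ?thesis unfolding step.simps by (metis d(2) e(2))
  qed
  moreover have "0 < min d e" using d(1) e(1) by simp
  ultimately show ?case by blast
qed

definition sqerr :: "(real \<Rightarrow> real) \<Rightarrow> dtree \<Rightarrow> real \<Rightarrow> real \<Rightarrow> real" where
  "sqerr g T a l = (\<integral>x. indicator {a..<a + l} x * (g x - step T a l x)\<^sup>2 \<partial>lborel)"

definition square_integrable :: "(real \<Rightarrow> real) \<Rightarrow> bool" where
  "square_integrable g \<longleftrightarrow> g \<in> borel_measurable borel \<and> integrable lborel (\<lambda>x. (g x)\<^sup>2)"

lemma integrable_indicator_Ico: "integrable lborel (\<lambda>x. indicator {a..<b} x * c)" for a b c :: real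
  by (cases "a \<le> b") (auto intro!: integrable_mult_left integrable_real_indicator)

lemma sqerr_integrable:
  assumes "square_integrable g" "0 \<le> l"
  shows "integrable lborel (\<lambda>x. indicator {a..<a + l} x * (g x - step T a l x)\<^sup>2)"
proof -
  have [measurable]: "g \<in> borel_measurable borel" using assms by (simp add: square_integrable_def)
  obtain B where B: "\<And>x. \<bar>step T a l x\<bar> \<le> B" using step_bounded by blast
  show ?thesis
  proof (rule Bochner_Integration.integrable_bound)
    show "integrable lborel (\<lambda>x. 2 * (g x)\<^sup>2 + indicator {a..<a + l} x * (2 * B\<^sup>2))"
      using assms integrable_indicator_Ico[of a "a + l"] by (intro Bochner_Integration.integrable_add) (auto simp: square_integrable_def)
    show "AE x in lborel. norm (indicator {a..<a + l} x * (g x - step T a l x)\<^sup>2)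
        \<le> norm (2 * (g x)\<^sup>2 + indicator {a..<a + l} x * (2 * B\<^sup>2))"
    proof (rule AE_I2)
      fix x
      have "(step T a l x)\<^sup>2 \<le> B\<^sup>2" using B[of x] by (metis abs_ge_zero power2_abs power_mono)
      then show "norm (indicator {a..<a + l} x * (g x - step T a l x)\<^sup>2)
          \<le> norm (2 * (g x)\<^sup>2 + indicator {a..<a + l} x * (2 * B\<^sup>2))"
        using add_square_le[of "g x" "- step T a l x"] by (auto simp: indicator_def)
    qed
  qed measurable
qed

lemma sqerr_nonneg: "0 \<le> sqerr g T a l"
  unfolding sqerr_def by (intro integral_nonneg_AE AE_I2) (auto simp: indicator_def)

lemma sqerr_Node:
  assumes g: "square_integrable g" and l: "0 \<le> l"
  shows "sqerr g (Node S T) a l = sqerr g S a (l / 2) + sqerr g T (a + l / 2) (l / 2)"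
proof -
  have "indicator {a..<a + l} x * (g x - step (Node S T) a l x)\<^sup>2
      = indicator {a..<a + l / 2} x * (g x - step S a (l / 2) x)\<^sup>2
        + indicator {a + l / 2..<a + l / 2 + l / 2} x * (g x - step T (a + l / 2) (l / 2) x)\<^sup>2" for x
    using l step_outside[of "l / 2" x a S] step_outside[of "l / 2" x "a + l / 2" T]
    by (auto simp: indicator_def)
  then show ?thesis
    unfolding sqerr_def using l
    by (simp only:) (intro Bochner_Integration.integral_add sqerr_integrable[OF g]; simp)
qed

text \<open>
  Distinct values on a cell are separated, so \<open>g\<close> can be close to few of them.
\<close>

lemma sqerr_Leaf_separated:
  assumes g: "square_integrable g" and l: "0 < l"
  shows "(real k - real j)\<^sup>2 \<le> 2 * sqerr g (Leaf k) a l + 2 * sqerr g (Leaf j) a l"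
proof -
  have "(real k - real j)\<^sup>2 = (\<integral>x. indicator {a..<a + l} x * ((real k - real j)\<^sup>2 / l) \<partial>lborel)"
    using l by simp
  also have "\<dots> \<le> (\<integral>x. 2 * (indicator {a..<a + l} x * (g x - step (Leaf k) a l x)\<^sup>2)
      + 2 * (indicator {a..<a + l} x * (g x - step (Leaf j) a l x)\<^sup>2) \<partial>lborel)"
  proof (rule integral_mono)
    fix x
    have "((real k - real j)\<^sup>2 / l) = ((real k / sqrt l - g x) + (g x - real j / sqrt l))\<^sup>2"
      using l by (simp add: power_divide flip: diff_divide_distrib)
    also have "\<dots> \<le> 2 * (g x - real k / sqrt l)\<^sup>2 + 2 * (g x - real j / sqrt l)\<^sup>2"
      using add_square_le[of "real k / sqrt l - g x" "g x - real j / sqrt l"] by (simp add: power2_commute)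
    finally show "indicator {a..<a + l} x * ((real k - real j)\<^sup>2 / l)
      \<le> 2 * (indicator {a..<a + l} x * (g x - step (Leaf k) a l x)\<^sup>2)
      + 2 * (indicator {a..<a + l} x * (g x - step (Leaf j) a l x)\<^sup>2)"
      by (auto simp: indicator_def)
  qed (use sqerr_integrable[OF g, of l] l integrable_indicator_Ico in \<open>auto simp del: step.simps\<close>)
  also have "\<dots> = 2 * sqerr g (Leaf k) a l + 2 * sqerr g (Leaf j) a l"
    unfolding sqerr_def using sqerr_integrable[OF g, of l] l
    by (subst Bochner_Integration.integral_add) (auto simp del: step.simps)
  finally show ?thesis .
qed

section \<open>Counting trees\<close>

text \<open>
  Each side of \<open>j\<close> contributes a geometric series with ratio \<open>\<rho> = exp (- 1 / 336)\<close>, and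
  \<open>1 / (1 - \<rho>) \<le> 337\<close>.
\<close>

lemma sum_exp_dist_le:
  fixes A :: "nat set"
  assumes "finite A"
  shows "(\<Sum>k\<in>A. exp (- \<bar>real k - real j\<bar> / 336)) \<le> 674"
proof -
  define \<rho> :: real where "\<rho> = exp (- 1 / 336)"
  have \<rho>: "0 < \<rho>" "\<rho> < 1" by (auto simp: \<rho>_def)
  have "\<rho> * (1 + 1 / 336) \<le> \<rho> * exp (1 / 336)"
    using \<rho> by (intro mult_left_mono exp_ge_add_one_self) auto
  also have "\<dots> = 1" by (simp add: \<rho>_def flip: exp_add)
  finally have "\<rho> \<le> 336 / 337" by simp
  then have geo: "1 / (1 - \<rho>) \<le> 337" using \<rho> by (simp add: field_simps)
  have pow: "exp (- real m / 336) = \<rho> ^ m" for m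
    by (simp add: \<rho>_def flip: exp_of_nat_mult)
  have part: "(\<Sum>k\<in>B. exp (- \<bar>real k - real j\<bar> / 336)) \<le> 337"
    if B: "finite B" "inj_on d B" "\<And>k. k \<in> B \<Longrightarrow> \<bar>real k - real j\<bar> = real (d k)" for B and d :: "nat \<Rightarrow> nat"
  proof -
    have "(\<Sum>k\<in>B. exp (- \<bar>real k - real j\<bar> / 336)) = (\<Sum>k\<in>B. \<rho> ^ d k)"
      using B(3) by (intro sum.cong) (simp_all only: pow)
    also have "\<dots> = (\<Sum>m\<in>d ` B. \<rho> ^ m)" using B(2) by (simp add: sum.reindex)
    also have "\<dots> \<le> (\<Sum>m. \<rho> ^ m)" using B(1) \<rho> by (intro sum_le_suminf) (auto intro: summable_geometric)
    also have "\<dots> \<le> 337" using \<rho> geo by (subst suminf_geometric) auto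
    finally show ?thesis .
  qed
  have "(\<Sum>k\<in>A. exp (- \<bar>real k - real j\<bar> / 336))
      = (\<Sum>k\<in>{k\<in>A. j \<le> k}. exp (- \<bar>real k - real j\<bar> / 336)) + (\<Sum>k\<in>{k\<in>A. k < j}. exp (- \<bar>real k - real j\<bar> / 336))"
    using assms by (subst sum.union_disjoint[symmetric]) (auto intro!: sum.cong)
  also have "\<dots> \<le> 337 + 337"
    using assms by (intro add_mono part[of _ "\<lambda>k. k - j"] part[of _ "\<lambda>k. j - k"]) (auto simp: inj_on_def of_nat_diff)
  finally show ?thesis by simp
qed

text \<open>
  If the value \<open>j\<close> is the best one for \<open>g\<close>, then the separation of the values shows that the squared
  error of \<open>k\<close> is at least \<open>(k - j)\<^sup>2 / 4\<close>.
\<close>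

lemma leaf_sum_le:
  assumes g: "square_integrable g" and l: "0 < l" and A: "finite A"
  shows "(\<Sum>k\<in>A. exp (- sqerr g (Leaf k) a l / 84)) \<le> 674"
proof (cases "A = {}")
  case False
  define j where "j = arg_min_on (\<lambda>k. sqerr g (Leaf k) a l) A"
  have j: "j \<in> A" "\<And>k. k \<in> A \<Longrightarrow> sqerr g (Leaf j) a l \<le> sqerr g (Leaf k) a l"
    unfolding j_def using A False by (auto intro: arg_min_if_finite(1) arg_min_least)
  have "(\<Sum>k\<in>A. exp (- sqerr g (Leaf k) a l / 84)) \<le> (\<Sum>k\<in>A. exp (- \<bar>real k - real j\<bar> / 336))"
  proof (rule sum_mono)
    fix k assume k: "k \<in> A"
    have "\<bar>real k - real j\<bar> \<le> (real k - real j)\<^sup>2"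
    proof (cases "k = j")
      case False
      then have "1 \<le> \<bar>real k - real j\<bar>" by (cases k j rule: linorder_cases) auto
      then have "\<bar>real k - real j\<bar> ^ 1 \<le> \<bar>real k - real j\<bar> ^ 2" by (intro power_increasing) auto
      then show ?thesis by simp
    qed simp
    also have "\<dots> \<le> 4 * sqerr g (Leaf k) a l"
      using sqerr_Leaf_separated[OF g l, of k j a] j(2)[OF k] by simp
    finally show "exp (- sqerr g (Leaf k) a l / 84) \<le> exp (- \<bar>real k - real j\<bar> / 336)" by simp
  qed
  also have "\<dots> \<le> 674" using A by (rule sum_exp_dist_le)
  finally show ?thesis .
qed simp

text \<open>
  A form of Kraft's inequality. By induction on the height, the leaves have total weight at most
  \<open>674 / 2696 = 1/4\<close>, and the weight of a node is the product of the weights of its subtrees on the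
  two half cells, so that the nodes contribute at most \<open>(1/2)\<^sup>2 = 1/4\<close>.
\<close>

theorem weighted_tree_sum_le:
  assumes g: "square_integrable g" and l: "0 < l" and F: "finite F"
  shows "(\<Sum>T\<in>F. (1 / 2696) ^ leaves T * exp (- sqerr g T a l / 84)) \<le> 1 / 2"
proof -
  have "(\<Sum>T\<in>F. (1 / 2696) ^ leaves T * exp (- sqerr g T a l / 84)) \<le> 1 / 2"
    if "finite F" "0 < l" "\<forall>T\<in>F. height T \<le> h" for F a l h
    using that
  proof (induction h arbitrary: F a l)
    case 0
    define A where "A = Leaf -` F"
    have A: "finite A" unfolding A_def using 0 by (intro finite_vimageI) (auto simp: inj_def)
    have "\<exists>k. T = Leaf k" if "T \<in> F" for T
      using 0(3) that by (cases T) force+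
    then have "F = Leaf ` A" unfolding A_def by fast
    then have "(\<Sum>T\<in>F. (1 / 2696) ^ leaves T * exp (- sqerr g T a l / 84))
        = (1 / 2696) * (\<Sum>k\<in>A. exp (- sqerr g (Leaf k) a l / 84))"
      by (simp add: sum.reindex inj_on_def sum_distrib_left)
    also have "\<dots> \<le> 1 / 2" using leaf_sum_le[OF g 0(2) A, of a] by simp
    finally show ?case .
  next
    case (Suc h)
    let ?w = "\<lambda>T a l. (1 / 2696) ^ leaves T * exp (- sqerr g T a l / 84)"
    define A where "A = Leaf -` F"
    define N where "N = F - range Leaf"
    define F1 where "F1 = (\<lambda>T. case T of Node S S' \<Rightarrow> S | Leaf k \<Rightarrow> Leaf k) ` N"
    define F2 where "F2 = (\<lambda>T. case T of Node S S' \<Rightarrow> S' | Leaf k \<Rightarrow> Leaf k) ` N"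
    have A: "finite A" unfolding A_def using Suc by (intro finite_vimageI) (auto simp: inj_def)
    have N: "finite N" "finite F1" "finite F2" unfolding N_def F1_def F2_def using Suc by auto
    have node: "\<exists>S S'. T = Node S S' \<and> S \<in> F1 \<and> S' \<in> F2 \<and> height S \<le> h \<and> height S' \<le> h" if T: "T \<in> N" for T
    proof (cases T)
      case (Node S S')
      have "S \<in> F1" unfolding F1_def using T Node by (intro image_eqI[of _ _ T]) auto
      moreover have "S' \<in> F2" unfolding F2_def using T Node by (intro image_eqI[of _ _ T]) auto
      moreover have "height T \<le> Suc h" using T Suc.prems(3) by (auto simp: N_def)
      ultimately show ?thesis using Node by simp
    qed (use T in \<open>auto simp: N_def\<close>)
    have heights: "\<forall>T\<in>F1. height T \<le> h" "\<forall>T\<in>F2. height T \<le> h"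
      unfolding F1_def F2_def by (auto dest!: node)
    have "(\<Sum>T\<in>F. ?w T a l) = (\<Sum>T\<in>Leaf ` A. ?w T a l) + (\<Sum>T\<in>N. ?w T a l)"
      using A N Suc.prems(1) by (subst sum.union_disjoint[symmetric]) (auto simp: A_def N_def intro!: sum.cong)
    also have "(\<Sum>T\<in>Leaf ` A. ?w T a l) = (1 / 2696) * (\<Sum>k\<in>A. exp (- sqerr g (Leaf k) a l / 84))"
      by (simp add: sum.reindex inj_on_def sum_distrib_left)
    also have "\<dots> \<le> 1 / 4" using leaf_sum_le[OF g Suc.prems(2) A, of a] by simp
    also have "(\<Sum>T\<in>N. ?w T a l) \<le> (\<Sum>T\<in>(\<lambda>(S, S'). Node S S') ` (F1 \<times> F2). ?w T a l)"
    proof (rule sum_mono2)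
      show "N \<subseteq> (\<lambda>(S, S'). Node S S') ` (F1 \<times> F2)" by (auto dest!: node)
    qed (use N in auto)
    also have "\<dots> = (\<Sum>(S, S')\<in>F1 \<times> F2. ?w S a (l / 2) * ?w S' (a + l / 2) (l / 2))"
    proof -
      have "?w (Node S S') a l = ?w S a (l / 2) * ?w S' (a + l / 2) (l / 2)" for S S'
        using sqerr_Node[OF g, of l S S' a] Suc.prems(2)
        by (simp add: power_add diff_divide_distrib flip: exp_add)
      then show ?thesis
        by (subst sum.reindex) (auto simp: inj_on_def case_prod_beta simp del: leaves.simps)
    qed
    also have "\<dots> = (\<Sum>S\<in>F1. ?w S a (l / 2)) * (\<Sum>S'\<in>F2. ?w S' (a + l / 2) (l / 2))"
      by (simp add: sum_product sum.cartesian_product)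
    also have "\<dots> \<le> (1 / 2) * (1 / 2)"
      using Suc.IH[OF N(2) _ heights(1), of "l / 2" a] Suc.IH[OF N(3) _ heights(2), of "l / 2" "a + l / 2"] Suc.prems(2)
      by (intro mult_mono sum_nonneg) auto
    finally show ?case by simp
  qed
  from this[OF F l, of "Max (height ` F)"] show ?thesis using F by simp
qed

text \<open>
  Every tree that is counted has weight at least \<open>2696\<^sup>-\<^sup>N exp (- R / 84)\<close>.
\<close>

lemma card_trees_near:
  assumes g: "square_integrable g" and l: "0 < l"
  shows "finite {T. leaves T = N \<and> sqerr g T a l < R} \<and>
    real (card {T. leaves T = N \<and> sqerr g T a l < R}) \<le> 2696 ^ N * exp (R / 84)"
proof -
  have le: "real (card G) \<le> 2696 ^ N * exp (R / 84)" if G: "G \<subseteq> {T. leaves T = N \<and> sqerr g T a l < R}" "finite G" for G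
  proof -
    have "real (card G) * ((1 / 2696) ^ N * exp (- R / 84)) = (\<Sum>T\<in>G. (1 / 2696) ^ N * exp (- R / 84))" by simp
    also have "\<dots> \<le> (\<Sum>T\<in>G. (1 / 2696) ^ leaves T * exp (- sqerr g T a l / 84))"
      using G(1) by (intro sum_mono mult_mono) auto
    also have "\<dots> \<le> 1 / 2" by (rule weighted_tree_sum_le[OF g l G(2)])
    finally show ?thesis by (simp add: exp_minus field_simps power_divide)
  qed
  have "finite {T. leaves T = N \<and> sqerr g T a l < R} \<and> card {T. leaves T = N \<and> sqerr g T a l < R} \<le> nat \<lfloor>2696 ^ N * exp (R / 84)\<rfloor>"
    by (intro finite_if_finite_subsets_card_bdd le_nat_floor le)
  then show ?thesis using le[OF subset_refl] by blast
qed

section \<open>Adaptive approximation of functions of bounded variation\<close>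

lemma power_variation_mono:
  assumes "A \<subseteq> B"
  shows "power_variation p f A \<le> power_variation p f B"
  unfolding power_variation_def using assms by (intro Sup_subset_mono) blast

lemma power_variation_cong:
  assumes "\<And>x. x \<in> A \<Longrightarrow> f x = g x"
  shows "power_variation p f A = power_variation p g A"
proof -
  have "(\<Sum>j=1..i. \<bar>f (x j) - f (x (j - 1))\<bar> powr p) = (\<Sum>j=1..i. \<bar>g (x j) - g (x (j - 1))\<bar> powr p)"
    if "\<forall>j\<le>i. x j \<in> A" for i and x :: "nat \<Rightarrow> real"
    using that assms by (intro sum.cong) auto
  then show ?thesis
    unfolding power_variation_def by (intro arg_cong[where f = Sup] Collect_cong iff_exI) auto
qed

lemma le_power_variation:
  assumes "x \<in> A" "y \<in> A"
  shows "ennreal (\<bar>f x - f y\<bar> powr p) \<le> power_variation p f A"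
proof -
  have less: "ennreal (\<bar>f v - f u\<bar> powr p) \<le> power_variation p f A" if "u < v" "u \<in> A" "v \<in> A" for u v
    unfolding power_variation_def
  proof (rule Sup_upper, safe intro!: exI)
    show "ennreal (\<bar>f v - f u\<bar> powr p)
      = ennreal (\<Sum>j=1..1. \<bar>f ((\<lambda>j. if j = (0::nat) then u else v) j) - f ((\<lambda>j. if j = (0::nat) then u else v) (j - 1))\<bar> powr p)"
      by simp
  qed (use that in auto)
  show ?thesis
    using less[of x y] less[of y x] assms by (cases x y rule: linorder_cases) (auto simp: abs_minus_commute)
qed

text \<open>
  Chains in \<open>A\<close> and in \<open>B\<close> can be joined to a chain in the union; the additional increment between
  them is nonnegative.
\<close>

lemma power_variation_superadditive:
  assumes less: "\<And>x y. x \<in> A \<Longrightarrow> y \<in> B \<Longrightarrow> x < y"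
  shows "power_variation p f A + power_variation p f B \<le> power_variation p f (A \<union> B)"
proof -
  define chain where "chain D i x \<longleftrightarrow> 1 \<le> i \<and> (\<forall>j<i. x j < x (Suc j)) \<and> (\<forall>j\<le>i. x j \<in> D)" for D i and x :: "nat \<Rightarrow> real"
  define v where "v i x = (\<Sum>j=1..i. \<bar>f (x j) - f (x (j - 1))\<bar> powr p)" for i and x :: "nat \<Rightarrow> real"
  have pv: "power_variation p f D = (SUP (i, x)\<in>{(i, x). chain D i x}. ennreal (v i x))" for D
    unfolding power_variation_def chain_def v_def by (intro arg_cong[where f = Sup]) auto
  have join: "ennreal (v i x) + ennreal (v k y) \<le> power_variation p f (A \<union> B)"
    if x: "chain A i x" and y: "chain B k y" for i x k y
  proof -
    \<comment> \<open>The second chain starts at index \<open>i + 1\<close>, one step after the end of the first.\<close>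
    define z where "z j = (if j \<le> i then x j else y (j - (i + 1)))" for j
    have "chain (A \<union> B) (i + k + 1) z"
      unfolding chain_def
    proof (intro conjI allI impI)
      fix j assume j: "j < i + k + 1"
      consider "j < i" | "j = i" | "i < j" by linarith
      then show "z j < z (Suc j)"
      proof cases
        case 1
        then show ?thesis using x by (simp add: z_def chain_def)
      next
        case 2
        then show ?thesis using x y by (auto simp: z_def chain_def intro!: less)
      next
        case 3
        then have Suc: "Suc j - (i + 1) = Suc (j - (i + 1))" by linarith
        have "z j = y (j - (i + 1))" "z (Suc j) = y (Suc j - (i + 1))" using 3 by (simp_all add: z_def)
        note this[unfolded Suc]
        moreover have "j - (i + 1) < k" using 3 j by linarith
        ultimately show ?thesis using y by (simp add: chain_def)
      qed
    next
      fix j assume j: "j \<le> i + k + 1"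
      show "z j \<in> A \<union> B"
      proof (cases "j \<le> i")
        case False
        then have "j - (i + 1) \<le> k" using j by linarith
        then show ?thesis using y False by (simp add: z_def chain_def)
      qed (use x in \<open>simp add: z_def chain_def\<close>)
    qed simp
    moreover have "v i x + v k y \<le> v (i + k + 1) z"
    proof -
      have "v i x = (\<Sum>j=1..i. \<bar>f (z j) - f (z (j - 1))\<bar> powr p)"
        unfolding v_def by (intro sum.cong) (auto simp: z_def)
      moreover have "v k y = (\<Sum>j\<in>(\<lambda>j. j + (i + 1)) ` {1..k}. \<bar>f (z j) - f (z (j - 1))\<bar> powr p)"
        unfolding v_def by (subst sum.reindex) (auto simp: z_def inj_on_def intro!: sum.cong)
      ultimately have "v i x + v k y = (\<Sum>j\<in>{1..i} \<union> (\<lambda>j. j + (i + 1)) ` {1..k}. \<bar>f (z j) - f (z (j - 1))\<bar> powr p)"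
        by (subst sum.union_disjoint) auto
      also have "\<dots> \<le> v (i + k + 1) z"
        unfolding v_def by (intro sum_mono2) auto
      finally show ?thesis .
    qed
    ultimately have "ennreal (v i x + v k y) \<le> power_variation p f (A \<union> B)"
      unfolding pv by (intro SUP_upper2[of "(i + k + 1, z)"]) (auto intro: ennreal_leI)
    moreover have "0 \<le> v i x" "0 \<le> v k y" unfolding v_def by (auto intro: sum_nonneg)
    ultimately show ?thesis by simp
  qed
  let ?CA = "{(i, x). chain A i x}" and ?CB = "{(i, x). chain B i x}"
  show ?thesis
  proof (cases "?CA = {} \<or> ?CB = {}")
    case True
    then have "power_variation p f A = 0 \<or> power_variation p f B = 0" by (auto simp: pv bot_ennreal)
    then show ?thesis using power_variation_mono[of A "A \<union> B" p f] power_variation_mono[of B "A \<union> B" p f] by auto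
  next
    case False
    have "power_variation p f A + ennreal (v k y) \<le> power_variation p f (A \<union> B)" if y: "chain B k y" for k y
      unfolding pv[of A] using False join[OF _ y]
      by (subst ennreal_SUP_add_left[symmetric]) (auto intro!: SUP_least)
    then show ?thesis
      unfolding pv[of B] using False
      by (subst ennreal_SUP_add_right) (auto intro!: SUP_least)
  qed
qed

text \<open>
  Concavity: \<open>z powr \<theta>\<close> lies below its tangent at the midpoint of \<open>x\<close> and \<open>y\<close>.
\<close>

lemma powr_add_le:
  fixes x y \<theta> :: real
  assumes x: "0 < x" and y: "0 < y" and \<theta>: "0 \<le> \<theta>" "\<theta> \<le> 1"
  shows "x powr \<theta> + y powr \<theta> \<le> 2 powr (1 - \<theta>) * (x + y) powr \<theta>"
proof -
  define m where "m = (x + y) / 2"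
  have m: "0 < m" using x y by (simp add: m_def)
  have tangent: "z powr \<theta> \<le> (\<theta> * (z / m) + (1 - \<theta>)) * m powr \<theta>" if "0 < z" for z
  proof -
    have "(z / m) powr \<theta> * 1 powr (1 - \<theta>) \<le> \<theta> * (z / m) + (1 - \<theta>) * 1"
      using that m \<theta> by (intro Youngs_inequality_0) auto
    then have "(z / m) powr \<theta> * m powr \<theta> \<le> (\<theta> * (z / m) + (1 - \<theta>)) * m powr \<theta>"
      by (intro mult_right_mono) auto
    then show ?thesis using that m by (simp add: powr_mult[symmetric])
  qed
  have "x powr \<theta> + y powr \<theta> \<le> (\<theta> * ((x + y) / m) + 2 * (1 - \<theta>)) * m powr \<theta>"
    using tangent[OF x] tangent[OF y] by (simp add: add_divide_distrib algebra_simps)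
  also have "(x + y) / m = 2" using m by (simp add: m_def divide_eq_eq)
  also have "(\<theta> * 2 + 2 * (1 - \<theta>)) * m powr \<theta> = 2 * m powr \<theta>" by simp
  also have "\<dots> = 2 powr (1 - \<theta>) * (x + y) powr \<theta>"
    using x y by (simp add: m_def powr_divide powr_diff)
  finally show ?thesis .
qed

text \<open>
  Bounds the number of cells of the adaptive partition of a cell of length \<open>l\<close> on which the
  \<open>p\<close>-variation is \<open>w\<close>, as a function of \<open>x = l\<^sup>p\<^sup>/\<^sup>2 w\<close>.
\<close>

definition leaf_bound :: "real \<Rightarrow> real \<Rightarrow> real" where
  "leaf_bound p x = (if x \<le> 1 then 1 else 5 * x powr (2 / (p + 2)))"

text \<open>
  The recursion for the number of cells. When a cell is halved, superadditivity of the variation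
  gives \<open>y + z \<le> 2\<^sup>-\<^sup>p\<^sup>/\<^sup>2 x\<close>. The exponent \<open>\<theta> = 2 / (p + 2)\<close> is critical: for \<open>y\<close>, \<open>z > 1\<close> the factor
  \<open>2\<^sup>1\<^sup>-\<^sup>\<theta>\<close> lost by concavity is exactly compensated by \<open>2\<^sup>-\<^sup>p\<^sup>\<theta>\<^sup>/\<^sup>2\<close>. If one of the halves is not split
  further, the factor 5 leaves enough room for its single cell.
\<close>

lemma leaf_bound_split:
  assumes p: "1 \<le> p" and x: "1 < x" and nn: "0 \<le> y" "0 \<le> z" and yz: "y + z \<le> 2 powr (- p / 2) * x"
  shows "leaf_bound p y + leaf_bound p z \<le> leaf_bound p x"
proof -
  define \<theta> where "\<theta> = 2 / (p + 2)"
  have \<theta>: "0 < \<theta>" "\<theta> \<le> 1" using p by (auto simp: \<theta>_def)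
  have p\<theta>: "p / 2 * \<theta> = 1 - \<theta>" using p by (simp add: \<theta>_def field_simps)
  have scale: "(2 powr (- p / 2) * x) powr \<theta> = 2 powr (- (1 - \<theta>)) * x powr \<theta>"
  proof -
    have "- p / 2 * \<theta> = - (p / 2 * \<theta>)" by simp
    also note p\<theta>
    finally have "- p / 2 * \<theta> = - (1 - \<theta>)" .
    then show ?thesis by (simp only: powr_mult powr_powr)
  qed
  have x\<theta>: "1 \<le> x powr \<theta>" using x \<theta> by (intro ge_one_powr_ge_zero) auto
  \<comment> \<open>If only one half is split further, its share is at most \<open>4/5\<close> of the bound, as \<open>p \<ge> 1\<close>.\<close>
  have third: "(2::real) powr (- (1 - \<theta>)) \<le> 4 / 5"
  proof -
    have "1 / 3 \<le> 1 - \<theta>" using p by (simp add: \<theta>_def field_simps)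
    then have "(2::real) powr (- (1 - \<theta>)) \<le> 2 powr (- (1 / 3))" by (intro powr_mono) auto
    also have "\<dots> \<le> 4 / 5"
    proof (rule power_le_imp_le_base)
      have "((2::real) powr (- (1 / 3))) ^ Suc 2 = 2 powr (- 1)"
      proof -
        have "((2::real) powr (- (1 / 3))) ^ Suc 2 = (2 powr (- (1 / 3))) powr real (Suc 2)"
          by (rule powr_realpow[symmetric]) simp
        also have "\<dots> = 2 powr (- (1 / 3) * real (Suc 2))" by (rule powr_powr)
        finally show ?thesis by simp
      qed
      also have "\<dots> = (1 / 2 :: real)" by (simp add: powr_minus)
      also have "\<dots> \<le> (4 / 5) ^ Suc 2" by (simp add: power_divide)
      finally show "((2::real) powr (- (1 / 3))) ^ Suc 2 \<le> (4 / 5) ^ Suc 2" .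
    qed simp
    finally show ?thesis .
  qed
  have one: "1 + 5 * w powr \<theta> \<le> 5 * x powr \<theta>" if w: "1 < w" "w \<le> 2 powr (- p / 2) * x" for w
  proof -
    have "w powr \<theta> \<le> (2 powr (- p / 2) * x) powr \<theta>" using w \<theta> by (intro powr_mono2) auto
    also have "\<dots> \<le> 4 / 5 * x powr \<theta>" unfolding scale using third by (intro mult_right_mono) auto
    finally show ?thesis using x\<theta> by simp
  qed
  have two: "y powr \<theta> + z powr \<theta> \<le> x powr \<theta>" if "1 < y" "1 < z"
  proof -
    have "y powr \<theta> + z powr \<theta> \<le> 2 powr (1 - \<theta>) * (y + z) powr \<theta>"
      using that \<theta> by (intro powr_add_le) auto
    also have "\<dots> \<le> 2 powr (1 - \<theta>) * (2 powr (- p / 2) * x) powr \<theta>"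
      using that \<theta> yz by (intro mult_left_mono powr_mono2) auto
    also have "\<dots> = x powr \<theta>" unfolding scale by (simp flip: powr_add mult.assoc)
    finally show ?thesis .
  qed
  show ?thesis
    using x x\<theta> one[of y] one[of z] two nn yz unfolding leaf_bound_def \<theta>_def[symmetric] by auto
qed

text \<open>
  The smallness condition says that the oscillation of \<open>g\<close> on the cell is at most \<open>1 / \<surd>l\<close>, and
  rounding a value of \<open>g\<close> to a multiple of \<open>1 / \<surd>l\<close> costs at most the same again. The cell may reach
  outside \<open>J\<close> at its left end point only.
\<close>

lemma ex_leaf_approximation:
  assumes g: "square_integrable g" "\<And>x. 0 \<le> g x" and p: "1 \<le> p"
    and l: "0 < l" and J: "{c<..<c + l} \<subseteq> J"
    and w: "power_variation p g ({c..<c + l} \<inter> J) \<le> ennreal w" "0 \<le> w"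
    and small: "l powr (p / 2) * w \<le> 1"
  shows "\<exists>k. sqerr g (Leaf k) c l \<le> 4"
proof -
  \<comment> \<open>An interior point of the cell, hence a point of \<open>J\<close>.\<close>
  define y where "y = c + l / 2"
  have y: "y \<in> {c..<c + l} \<inter> J" using J l by (auto simp: y_def)
  define k where "k = nat \<lfloor>sqrt l * g y\<rfloor>"
  have "0 \<le> sqrt l * g y" using l g(2)[of y] by simp
  then have "real k \<le> sqrt l * g y" "sqrt l * g y \<le> real k + 1"
    unfolding k_def by linarith+
  then have "\<bar>sqrt l * g y - real k\<bar> / sqrt l \<le> 1 / sqrt l"
    using l by (intro divide_right_mono) auto
  moreover have "g y - real k / sqrt l = (sqrt l * g y - real k) / sqrt l"
    using l by (simp add: diff_divide_distrib)
  ultimately have k: "\<bar>g y - real k / sqrt l\<bar> \<le> 1 / sqrt l"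
    using l by simp
  have osc: "\<bar>g x - g y\<bar> \<le> 1 / sqrt l" if x: "x \<in> {c..<c + l} \<inter> J" for x
  proof -
    have "ennreal (\<bar>g x - g y\<bar> powr p) \<le> ennreal w"
      using le_power_variation[OF x y, of g p] w(1) by (rule order_trans)
    then have "\<bar>g x - g y\<bar> powr p \<le> w" using w(2) by simp
    then have "l powr (p / 2) * \<bar>g x - g y\<bar> powr p \<le> l powr (p / 2) * w"
      by (intro mult_left_mono) auto
    also note small
    finally have "l powr (p / 2) * \<bar>g x - g y\<bar> powr p \<le> 1" .
    also have "l powr (p / 2) * \<bar>g x - g y\<bar> powr p = (sqrt l * \<bar>g x - g y\<bar>) powr p"
      using l by (simp add: powr_mult powr_powr flip: powr_half_sqrt)
    finally have "((sqrt l * \<bar>g x - g y\<bar>) powr p) powr (1 / p) \<le> 1 powr (1 / p)"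
      using p by (intro powr_mono2) auto
    then have "sqrt l * \<bar>g x - g y\<bar> \<le> 1" using p l by (simp add: powr_powr)
    then show ?thesis using l by (simp add: field_simps)
  qed
  have "sqerr g (Leaf k) c l \<le> (\<integral>x. indicator {c..<c + l} x * (4 / l) \<partial>lborel)"
    unfolding sqerr_def
  proof (rule integral_mono_AE)
    have "AE x in lborel. x \<noteq> c" by (rule AE_lborel_singleton)
    then show "AE x in lborel. indicator {c..<c + l} x * (g x - step (Leaf k) c l x)\<^sup>2 \<le> indicator {c..<c + l} x * (4 / l)"
    proof eventually_elim
      case (elim x)
      show ?case
      proof (cases "x \<in> {c..<c + l}")
        case True
        then have "x \<in> J" using J elim by auto
        then have "\<bar>g x - g y\<bar> \<le> 1 / sqrt l" using osc True by simp
        then have "\<bar>g x - real k / sqrt l\<bar> \<le> 2 / sqrt l" using k by linarith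
        then have "(g x - real k / sqrt l)\<^sup>2 \<le> (2 / sqrt l)\<^sup>2"
          by (metis abs_ge_zero power2_abs power_mono)
        also have "\<dots> = 4 / l" using l by (simp add: power_divide)
        finally show ?thesis using True by simp
      qed simp
    qed
  qed (use sqerr_integrable[OF g(1)] l integrable_indicator_Ico in \<open>auto simp del: step.simps\<close>)
  also have "\<dots> = 4" using l by simp
  finally show ?thesis by blast
qed

text \<open>
  Split until the smallness condition of a single leaf holds. At each halving the quantity
  \<open>l\<^sup>p\<^sup>/\<^sup>2 w\<close> decreases at least by the factor \<open>2\<^sup>-\<^sup>1\<^sup>/\<^sup>2\<close>, so that the recursion ends.
\<close>

lemma ex_tree_approximation:
  assumes g: "square_integrable g" "\<And>x. 0 \<le> g x" and p: "1 \<le> p"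
    and l: "0 < l" and J: "{c<..<c + l} \<subseteq> J"
    and w: "power_variation p g ({c..<c + l} \<inter> J) \<le> ennreal w" "0 \<le> w"
  shows "\<exists>T. sqerr g T c l \<le> 4 * real (leaves T) \<and> real (leaves T) \<le> leaf_bound p (l powr (p / 2) * w)"
proof -
  have leaf_witness: "\<exists>T. sqerr g T c l \<le> 4 * real (leaves T) \<and> real (leaves T) \<le> leaf_bound p x"
    if "\<exists>k. sqerr g (Leaf k) c l \<le> 4" "x \<le> 1" for c l x
  proof -
    from that(1) obtain k where "sqerr g (Leaf k) c l \<le> 4" by blast
    then show ?thesis using that(2) by (intro exI[of _ "Leaf k"]) (simp add: leaf_bound_def)
  qed
  have "\<exists>T. sqerr g T c l \<le> 4 * real (leaves T) \<and> real (leaves T) \<le> leaf_bound p (l powr (p / 2) * w)"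
    if "l powr (p / 2) * w \<le> 2 powr (real n / 2)" "0 < l" "{c<..<c + l} \<subseteq> J"
      "power_variation p g ({c..<c + l} \<inter> J) \<le> ennreal w" "0 \<le> w" for n c l w
    using that
  proof (induction n arbitrary: c l w)
    case (Suc n)
    note l = Suc.prems(2) and J = Suc.prems(3) and w = Suc.prems(4,5)
    let ?x = "l powr (p / 2) * w"
    show ?case
    proof (cases "?x \<le> 1")
      case True
      show ?thesis by (rule leaf_witness[OF ex_leaf_approximation[OF g p l J w True] True])
    next
      case False
      let ?A = "{c..<c + l / 2} \<inter> J" and ?B = "{c + l / 2..<c + l} \<inter> J"
      have "power_variation p g ?A + power_variation p g ?B \<le> power_variation p g (?A \<union> ?B)"
        by (rule power_variation_superadditive) auto
      also have "?A \<union> ?B = {c..<c + l} \<inter> J" using l by auto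
      also note w(1)
      finally have sum: "power_variation p g ?A + power_variation p g ?B \<le> ennreal w" .
      define wA wB where "wA = enn2real (power_variation p g ?A)" and "wB = enn2real (power_variation p g ?B)"
      have "power_variation p g ?A \<noteq> \<infinity>" "power_variation p g ?B \<noteq> \<infinity>"
        using sum by (auto simp: top_unique)
      then have wAB: "power_variation p g ?A = ennreal wA" "power_variation p g ?B = ennreal wB" "0 \<le> wA" "0 \<le> wB"
        by (auto simp: wA_def wB_def less_top)
      then have "wA + wB \<le> w" using sum w by (simp flip: ennreal_plus)
      have half: "(l / 2) powr (p / 2) = 2 powr (- p / 2) * l powr (p / 2)"
        using l by (simp add: powr_divide powr_minus field_simps)
      have split: "(l / 2) powr (p / 2) * wA + (l / 2) powr (p / 2) * wB \<le> 2 powr (- p / 2) * ?x"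
        using \<open>wA + wB \<le> w\<close> unfolding half by (simp add: mult_left_mono flip: distrib_left mult.assoc)
      also have "\<dots> \<le> 2 powr (- 1 / 2) * 2 powr (real (Suc n) / 2)"
        using p Suc.prems(1) w(2) by (intro mult_mono powr_mono) auto
      also have "\<dots> = 2 powr (real n / 2)" by (simp add: add_divide_distrib flip: powr_add)
      finally have sum_le: "(l / 2) powr (p / 2) * wA + (l / 2) powr (p / 2) * wB \<le> 2 powr (real n / 2)" .
      have nn: "0 \<le> (l / 2) powr (p / 2) * wA" "0 \<le> (l / 2) powr (p / 2) * wB" using wAB by auto
      have sub: "{c<..<c + l / 2} \<subseteq> J" "{c + l / 2<..<c + l / 2 + l / 2} \<subseteq> J"
        using J l by (auto intro: subsetD)
      obtain S where S: "sqerr g S c (l / 2) \<le> 4 * real (leaves S)" "real (leaves S) \<le> leaf_bound p ((l / 2) powr (p / 2) * wA)"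
        using Suc.IH[of "l / 2" wA c, OF _ _ sub(1)] sum_le nn wAB l by auto
      obtain T where T: "sqerr g T (c + l / 2) (l / 2) \<le> 4 * real (leaves T)" "real (leaves T) \<le> leaf_bound p ((l / 2) powr (p / 2) * wB)"
        using Suc.IH[of "l / 2" wB "c + l / 2", OF _ _ sub(2)] sum_le nn wAB l by (auto simp: add.commute)
      have "leaf_bound p ((l / 2) powr (p / 2) * wA) + leaf_bound p ((l / 2) powr (p / 2) * wB) \<le> leaf_bound p ?x"
        using False split nn by (intro leaf_bound_split[OF p]) auto
      then show ?thesis
        using S T sqerr_Node[OF g(1), of l S T c] l by (intro exI[of _ "Node S T"]) auto
    qed
  next
    case 0
    then have "l powr (p / 2) * w \<le> 1" by simp
    then show ?case
      by (intro leaf_witness ex_leaf_approximation[OF g p 0(2-5)])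
  qed
  moreover obtain n where "l powr (p / 2) * w \<le> 2 powr (real n / 2)"
  proof -
    let ?x = "l powr (p / 2) * w"
    obtain n where "?x < 2 ^ n" using real_arch_pow[of 2 ?x] by auto
    also have "(2::real) ^ n = 2 powr (real (2 * n) / 2)" by (simp add: powr_realpow)
    finally show ?thesis by (intro that[of "2 * n"]) simp
  qed
  ultimately show ?thesis using l J w by blast
qed

section \<open>The models\<close>

definition intensity :: "real \<Rightarrow> real \<Rightarrow> dtree \<Rightarrow> real \<Rightarrow> real" where
  "intensity a L T x = (step T a L x)\<^sup>2"

definition sqrt_on :: "real set \<Rightarrow> (real \<Rightarrow> real) \<Rightarrow> real \<Rightarrow> real" where
  "sqrt_on J t x = indicator J x * sqrt (t x)"

definition tree_model :: "real \<Rightarrow> real \<Rightarrow> nat \<Rightarrow> (real \<Rightarrow> real) set" where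
  "tree_model a L N = intensity a L ` {T. leaves T = N}"

text \<open>
  The factor 84 makes \<open>exp (- \<eta>\<^sup>2 / 84) = exp (- N)\<close>. It is large enough for the number \<open>2696\<^sup>N\<close> of the
  counting estimate to be absorbed by \<open>exp (\<eta>\<^sup>2 / 7)\<close>.
\<close>

definition tree_eta :: "nat \<Rightarrow> real" where
  "tree_eta N = sqrt (84 * real N)"

abbreviation tree_penalty :: "real \<Rightarrow> real \<Rightarrow> (real \<Rightarrow> real) \<Rightarrow> real" where
  "tree_penalty a L \<equiv> eta_of {1..} (tree_model a L) tree_eta"

lemma UN_tree_model: "(\<Union>N\<in>{1..}. tree_model a L N) = range (intensity a L)"
proof -
  have "intensity a L T \<in> (\<Union>N\<in>{1..}. tree_model a L N)" for T
    using leaves_pos[of T] by (intro UN_I[of "leaves T"]) (auto simp: tree_model_def Suc_le_eq)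
  then show ?thesis by (auto simp: tree_model_def)
qed

instance dtree :: countable
  by countable_datatype

lemma countable_intensities: "countable (range (intensity a L))"
  by (intro countable_image countableI_type)

text \<open>
  A function can be given by many trees; its penalty comes from one with the fewest leaves.
\<close>

lemma tree_penalty_attained:
  assumes "u \<in> range (intensity a L)"
  obtains T where "u = intensity a L T" "(tree_penalty a L u)\<^sup>2 = 84 * real (leaves T)"
    and "\<And>T'. u = intensity a L T' \<Longrightarrow> \<bar>tree_penalty a L u\<bar> \<le> sqrt (84 * real (leaves T'))"
proof -
  let ?P = "\<lambda>N. N \<in> {1..} \<and> u \<in> tree_model a L N"
  define N where "N = (LEAST N. ?P N)"
  have "\<exists>N. ?P N" using assms UN_tree_model[of a L] by blast
  then have N: "?P N" unfolding N_def by (rule LeastI_ex)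
  have least: "N \<le> N'" if "?P N'" for N' unfolding N_def by (rule Least_le) (rule that)
  have pen: "tree_penalty a L u = tree_eta N"
    unfolding eta_of_def
  proof (rule cInf_eq_minimum)
    show "tree_eta N \<in> {tree_eta m |m. m \<in> {1..} \<and> u \<in> tree_model a L m}" using N by blast
    show "tree_eta N \<le> y" if "y \<in> {tree_eta m |m. m \<in> {1..} \<and> u \<in> tree_model a L m}" for y
      using that least by (auto simp: tree_eta_def)
  qed
  obtain T where T: "u = intensity a L T" "leaves T = N" using N by (auto simp: tree_model_def)
  have "\<bar>tree_penalty a L u\<bar> \<le> sqrt (84 * real (leaves T'))" if "u = intensity a L T'" for T'
  proof -
    have "N \<le> leaves T'"
      using that leaves_pos[of T'] by (intro least) (auto simp: tree_model_def Suc_le_eq)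
    then show ?thesis unfolding pen by (simp add: tree_eta_def)
  qed
  then show ?thesis using that[OF T(1)] unfolding pen T(2) by (simp add: tree_eta_def)
qed

lemma le_exp_12: "(2696::real) \<le> exp 12"
proof -
  have "(2::real) ^ 12 \<le> exp 1 ^ 12" using exp_ge_add_one_self[of "1::real"] by (intro power_mono) auto
  also have "\<dots> = exp 12" by (simp flip: exp_of_nat_mult)
  finally show ?thesis by simp
qed

lemma nn_integral_count_space_le:
  fixes f :: "'a \<Rightarrow> ennreal"
  assumes A: "countable A" and le: "\<And>F. finite F \<Longrightarrow> F \<subseteq> A \<Longrightarrow> sum f F \<le> c"
  shows "(\<integral>\<^sup>+x. f x \<partial>count_space A) \<le> c"
proof (cases "finite A")
  case True
  then show ?thesis using le[of A] by (simp add: nn_integral_count_space_finite)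
next
  case False
  note bij = bij_betw_from_nat_into[OF A False]
  have "(\<integral>\<^sup>+x. f x \<partial>count_space A) = (\<Sum>n. f (from_nat_into A n))"
    using nn_integral_bij_count_space[OF bij, of f] by (simp add: nn_integral_count_space_nat)
  also have "\<dots> \<le> c"
    unfolding suminf_eq_SUP
  proof (rule SUP_least)
    fix n
    have inj: "inj_on (from_nat_into A) {..<n}" using bij by (auto simp: bij_betw_def intro: inj_on_subset)
    have "(\<Sum>i<n. f (from_nat_into A i)) = sum f (from_nat_into A ` {..<n})"
      using inj by (simp add: sum.reindex)
    also have "\<dots> \<le> c" using bij by (intro le) (auto simp: bij_betw_def)
    finally show "(\<Sum>i<n. f (from_nat_into A i)) \<le> c" .
  qed
  finally show ?thesis .
qed

locale nondegenerate_interval =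
  fixes J :: "real set" and a L :: real
  assumes L: "0 < L" and inner: "{a<..<a + L} \<subseteq> J" and outer: "J \<subseteq> {a..a + L}"
begin

lemma J_borel [measurable]: "J \<in> sets borel"
proof -
  have "J = {a<..<a + L} \<union> J \<inter> {a, a + L}" using inner outer by fastforce
  moreover have "finite (J \<inter> {a, a + L})" by simp
  ultimately show ?thesis
    by (metis borel_closed finite_imp_closed borel_open open_greaterThanLessThan sets.Un)
qed

lemma finite_measure_J: "finite_measure (leb_on J)"
  using outer by (intro finite_measure_leb_on J_borel) (rule bounded_subset[OF bounded_closed_interval])

lemma AE_cell: "AE x in lborel. indicator J x = (indicator {a..<a + L} x :: real)"
proof -
  have "AE x in lborel. x \<noteq> a" "AE x in lborel. x \<noteq> a + L" by (rule AE_lborel_singleton)+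
  then show ?thesis
  proof eventually_elim
    case (elim x)
    then show ?case using inner outer by (fastforce simp: indicator_def)
  qed
qed

lemma intensity_L1plus: "intensity a L T \<in> L1plus J"
proof -
  interpret finite_measure "leb_on J" by (rule finite_measure_J)
  obtain B where B: "\<And>x. \<bar>step T a L x\<bar> \<le> B" using step_bounded by blast
  have "integrable (leb_on J) (intensity a L T)"
  proof (rule integrable_const_bound[where B = "B\<^sup>2"])
    show "AE x in leb_on J. norm (intensity a L T x) \<le> B\<^sup>2"
    proof (rule AE_I2)
      fix x
      have "(step T a L x)\<^sup>2 \<le> B\<^sup>2" using B[of x] by (metis abs_ge_zero power2_abs power_mono)
      then show "norm (intensity a L T x) \<le> B\<^sup>2" by (simp add: intensity_def)
    qed
    show "intensity a L T \<in> borel_measurable (leb_on J)"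
      unfolding leb_on_def intensity_def[abs_def] by (rule measurable_restrict_space1) measurable
  qed
  then show ?thesis by (simp add: L1plus_def intensity_def)
qed

lemma square_integrable_sqrt_on:
  assumes t: "t \<in> L1plus J"
  shows "square_integrable (sqrt_on J t)"
proof -
  have int: "integrable (restrict_space lborel J) t" using t by (simp add: L1plus_def leb_on_def)
  have "(\<lambda>x. sqrt (t x)) \<in> borel_measurable (restrict_space lborel J)"
    using borel_measurable_integrable[OF int] by measurable
  then have "(\<lambda>x. indicator J x *\<^sub>R sqrt (t x)) \<in> borel_measurable lborel"
    by (subst (asm) borel_measurable_restrict_space_iff) auto
  then have "sqrt_on J t \<in> borel_measurable borel" by (simp add: sqrt_on_def[abs_def])
  moreover have "integrable lborel (\<lambda>x. indicator J x *\<^sub>R t x)"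
    using int by (subst (asm) integrable_restrict_space) auto
  then have "integrable lborel (\<lambda>x. (sqrt_on J t x)\<^sup>2)"
    by (rule Bochner_Integration.integrable_cong[THEN iffD1, rotated 2])
      (use t in \<open>auto simp: sqrt_on_def L1plus_def indicator_def\<close>)
  ultimately show ?thesis by (simp add: square_integrable_def)
qed

lemma hdist_intensity:
  assumes t: "t \<in> L1plus J"
  shows "(hdist J t (intensity a L T))\<^sup>2 = sqerr (sqrt_on J t) T a L / 2"
proof -
  have [measurable]: "sqrt_on J t \<in> borel_measurable borel"
    using square_integrable_sqrt_on[OF t] by (simp add: square_integrable_def)
  have "(\<integral>x. (sqrt (t x) - sqrt (intensity a L T x))\<^sup>2 \<partial>leb_on J)
      = (\<integral>x. indicator J x * (sqrt_on J t x - step T a L x)\<^sup>2 \<partial>lborel)"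
    unfolding leb_on_def
    by (subst integral_restrict_space)
      (use L in \<open>auto simp: sqrt_on_def intensity_def step_nonneg indicator_def intro!: Bochner_Integration.integral_cong\<close>)
  also have "\<dots> = sqerr (sqrt_on J t) T a L"
    unfolding sqerr_def using AE_cell by (intro integral_cong_AE) (auto elim: eventually_mono)
  finally show ?thesis
    using hdist_eq[OF J_borel t intensity_L1plus[of T]] by (simp add: sqerr_nonneg)
qed

text \<open>
  Step functions that are continuous from the right and differ at one point differ on an interval.
\<close>

lemma intensity_AE_eq_imp_eq:
  assumes ae: "AE x in leb_on J. intensity a L S x = intensity a L T x"
  shows "intensity a L S = intensity a L T"
proof (rule ccontr)
  assume "intensity a L S \<noteq> intensity a L T"
  then obtain x where x: "intensity a L S x \<noteq> intensity a L T x" by blast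
  then have cell: "x \<in> {a..<a + L}"
  proof (rule contrapos_np)
    assume "x \<notin> {a..<a + L}"
    then have "step S a L x = 0" "step T a L x = 0" using L by (auto intro!: step_outside)
    then show "intensity a L S x = intensity a L T x" by (simp add: intensity_def)
  qed
  obtain d where d: "0 < d" "\<And>y. y \<in> {x..<x + d} \<Longrightarrow> step S a L y = step S a L x"
    using step_right_constant[OF L, of x S a] by blast
  obtain e where e: "0 < e" "\<And>y. y \<in> {x..<x + e} \<Longrightarrow> step T a L y = step T a L x"
    using step_right_constant[OF L, of x T a] by blast
  define b where "b = min (a + L) (min (x + d) (x + e))"
  have xb: "x < b" using d(1) e(1) cell by (simp add: b_def)
  have "AE y in lborel. y \<in> J \<longrightarrow> intensity a L S y = intensity a L T y"
    using ae unfolding leb_on_def by (subst (asm) AE_restrict_space_iff) auto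
  then have "AE y in lborel. y \<notin> {x<..<b}"
  proof eventually_elim
    case (elim y)
    show ?case
    proof
      assume y: "y \<in> {x<..<b}"
      then have "y \<in> {a<..<a + L}" "y \<in> {x..<x + d}" "y \<in> {x..<x + e}" using cell by (auto simp: b_def)
      then show False using elim inner x d(2)[of y] e(2)[of y] by (auto simp: intensity_def)
    qed
  qed
  then have "{x<..<b} \<in> null_sets lborel" by (subst AE_iff_null_sets) auto
  then show False using xb by (simp add: null_sets_def)
qed

text \<open>
  A ball of radius \<open>x \<eta>\<close> contains at most \<open>2696\<^sup>N exp (2 N x\<^sup>2)\<close> functions of the model, and for \<open>x \<ge> 2\<close>
  the first factor is at most \<open>exp (12 N) \<le> exp (3 N x\<^sup>2)\<close>.
\<close>

lemma D_model_tree_model: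
  assumes N: "1 \<le> N"
  shows "D_model (L1plus J) (hdist J) (tree_model a L N) (tree_eta N) (5 * real N) 1"
  unfolding D_model_def
proof (intro conjI ballI allI impI)
  fix t and x :: real assume t: "t \<in> L1plus J" and x: "2 \<le> x"
  let ?A = "{T. leaves T = N \<and> sqerr (sqrt_on J t) T a L < 168 * real N * x\<^sup>2}"
  have sub: "{u \<in> tree_model a L N. hdist J t u < x * tree_eta N} \<subseteq> intensity a L ` ?A"
  proof
    fix u assume u: "u \<in> {u \<in> tree_model a L N. hdist J t u < x * tree_eta N}"
    then obtain T where T: "u = intensity a L T" "leaves T = N" by (auto simp: tree_model_def)
    have "(hdist J t u)\<^sup>2 < (x * tree_eta N)\<^sup>2"
      using u hdist_nonneg by (intro power_strict_mono) auto
    then have "sqerr (sqrt_on J t) T a L < 168 * real N * x\<^sup>2"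
      using hdist_intensity[OF t, of T] T(1) by (simp add: power_mult_distrib tree_eta_def mult_ac)
    then show "u \<in> intensity a L ` ?A" using T by auto
  qed
  have A: "finite ?A" "real (card ?A) \<le> 2696 ^ N * exp (168 * real N * x\<^sup>2 / 84)"
    using card_trees_near[OF square_integrable_sqrt_on[OF t] L, of N a "168 * real N * x\<^sup>2"] by blast+
  show "finite {u \<in> tree_model a L N. hdist J t u < x * tree_eta N}"
    using sub A(1) by (meson finite_imageI finite_subset)
  have "card {u \<in> tree_model a L N. hdist J t u < x * tree_eta N} \<le> card ?A"
    using sub A(1) by (meson card_image_le card_mono finite_imageI order_trans)
  then have "real (card {u \<in> tree_model a L N. hdist J t u < x * tree_eta N})
      \<le> 2696 ^ N * exp (168 * real N * x\<^sup>2 / 84)"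
    using A(2) by linarith
  also have "\<dots> \<le> exp (12 * real N) * exp (2 * real N * x\<^sup>2)"
  proof (intro mult_mono)
    have "(2696::real) ^ N \<le> exp 12 ^ N" using le_exp_12 by (intro power_mono) auto
    then show "(2696::real) ^ N \<le> exp (12 * real N)" by (simp add: mult.commute flip: exp_of_nat_mult)
  qed auto
  also have "\<dots> \<le> 1 * exp (5 * real N * x\<^sup>2)"
  proof -
    have "(2::real)\<^sup>2 \<le> x\<^sup>2" using x by (intro power_mono) auto
    then have "real N * (3 * 4) \<le> real N * (3 * x\<^sup>2)" by (intro mult_left_mono) auto
    then show ?thesis by (simp add: algebra_simps flip: exp_add)
  qed
  finally show "real (card {u \<in> tree_model a L N. hdist J t u < x * tree_eta N}) \<le> 1 * exp (5 * real N * x\<^sup>2)" .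
qed (use N intensity_L1plus in \<open>auto simp: tree_model_def tree_eta_def\<close>)

lemma model_family_trees:
  "model_family J {1..} (tree_model a L) tree_eta (\<lambda>N. 5 * real N) 1"
  unfolding model_family_def UN_tree_model
proof (intro conjI ballI impI)
  fix N :: nat assume "N \<in> {1..}"
  then have N: "1 \<le> N" by simp
  then show "D_model (L1plus J) (hdist J) (tree_model a L N) (tree_eta N) (5 * real N) 1"
    by (rule D_model_tree_model)
  show "1 / 2 \<le> 5 * real N" using N by simp
  show "84 * (5 * real N) / 5 \<le> (tree_eta N)\<^sup>2" by (simp add: tree_eta_def)
next
  have eq: "exp (- (tree_eta N)\<^sup>2 / 84) = exp (- 1) ^ N" for N
    by (simp add: tree_eta_def flip: exp_of_nat_mult)
  have "(\<lambda>N::nat. exp (- 1 :: real) ^ N) summable_on UNIV"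
    by (intro norm_summable_imp_summable_on) (simp add: norm_power summable_geometric)
  then show "(\<lambda>N. exp (- (tree_eta N)\<^sup>2 / 84)) summable_on {1..}"
    unfolding eq by (rule summable_on_subset_banach) simp
qed (use intensity_AE_eq_imp_eq in auto)

lemma integral_intensity: "(\<integral>x. intensity a L T x \<partial>leb_on J) = sqerr (\<lambda>_. 0) T a L"
proof -
  have z: "(\<lambda>_. 0) \<in> L1plus J" by (simp add: L1plus_def)
  have "sqrt_on J (\<lambda>_. 0) = (\<lambda>_. 0)" by (simp add: sqrt_on_def fun_eq_iff)
  then have "(hdist J (\<lambda>_. 0) (intensity a L T))\<^sup>2 = sqerr (\<lambda>_. 0) T a L / 2"
    using hdist_intensity[OF z, of T] by simp
  then show ?thesis
    using hdist_eq[OF J_borel z intensity_L1plus[of T]]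
    by (simp add: intensity_def integral_nonneg_AE)
qed

text \<open>
  The cost bounds both the number of leaves and the distance from zero.
\<close>

lemma finite_cost_sublevel:
  "finite {u \<in> range (intensity a L). cost J (tree_penalty a L) u \<le> K}"
proof (rule finite_subset)
  show "{u \<in> range (intensity a L). cost J (tree_penalty a L) u \<le> K}
      \<subseteq> (\<Union>N\<in>{..nat \<lfloor>K\<rfloor>}. intensity a L ` {T. leaves T = N \<and> sqerr (\<lambda>_. 0) T a L < K + 1})"
  proof
    fix u assume u: "u \<in> {u \<in> range (intensity a L). cost J (tree_penalty a L) u \<le> K}"
    then obtain T where T: "u = intensity a L T" "(tree_penalty a L u)\<^sup>2 = 84 * real (leaves T)"
      using tree_penalty_attained[of u a L] by blast
    have "sqerr (\<lambda>_. 0) T a L + 84 * real (leaves T) \<le> K"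
      using u T integral_intensity[of T] by (simp add: cost_def)
    then have "real (leaves T) \<le> K" "sqerr (\<lambda>_. 0) T a L < K + 1"
      using sqerr_nonneg[of "\<lambda>_. 0" T a L] by linarith+
    then show "u \<in> (\<Union>N\<in>{..nat \<lfloor>K\<rfloor>}. intensity a L ` {T. leaves T = N \<and> sqerr (\<lambda>_. 0) T a L < K + 1})"
      using T(1) by (auto simp: le_nat_floor)
  qed
  have "square_integrable (\<lambda>_. 0)" by (simp add: square_integrable_def)
  then show "finite (\<Union>N\<in>{..nat \<lfloor>K\<rfloor>}. intensity a L ` {T. leaves T = N \<and> sqerr (\<lambda>_. 0) T a L < K + 1})"
    using card_trees_near[OF _ L] by blast
qed

text \<open>
  Represent each candidate by a tree with the fewest leaves and compare with the weights of the
  trees.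
\<close>

lemma tree_penalised_sum_le:
  assumes t: "t \<in> L1plus J"
  shows "(\<integral>\<^sup>+u. ennreal (exp (- (hdist J t u)\<^sup>2 / 8 - (tree_penalty a L u)\<^sup>2 / 4))
    \<partial>count_space (range (intensity a L))) \<le> 1"
proof (rule nn_integral_count_space_le[OF countable_intensities])
  fix F assume F: "finite F" "F \<subseteq> range (intensity a L)"
  let ?e = "tree_penalty a L"
  have "\<forall>u\<in>F. \<exists>T. u = intensity a L T \<and> (?e u)\<^sup>2 = 84 * real (leaves T)"
    using F(2) tree_penalty_attained by (metis subsetD)
  then obtain \<tau> where \<tau>: "\<And>u. u \<in> F \<Longrightarrow> u = intensity a L (\<tau> u)" "\<And>u. u \<in> F \<Longrightarrow> (?e u)\<^sup>2 = 84 * real (leaves (\<tau> u))"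
    by metis
  have "(\<Sum>u\<in>F. exp (- (hdist J t u)\<^sup>2 / 8 - (?e u)\<^sup>2 / 4))
      \<le> (\<Sum>u\<in>F. (1 / 2696) ^ leaves (\<tau> u) * exp (- sqerr (sqrt_on J t) (\<tau> u) a L / 84))"
  proof (rule sum_mono)
    fix u assume u: "u \<in> F"
    have "exp (- (hdist J t u)\<^sup>2 / 8 - (?e u)\<^sup>2 / 4)
        = exp (- 21 * real (leaves (\<tau> u))) * exp (- sqerr (sqrt_on J t) (\<tau> u) a L / 16)"
      using hdist_intensity[OF t, of "\<tau> u"] \<tau>[OF u] by (simp flip: exp_add)
    also have "\<dots> \<le> (1 / 2696) ^ leaves (\<tau> u) * exp (- sqerr (sqrt_on J t) (\<tau> u) a L / 84)"
    proof (rule mult_mono)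
      have "(2696::real) \<le> exp 21" using le_exp_12 by (rule order_trans) simp
      then have "2696 ^ leaves (\<tau> u) \<le> (exp 21 :: real) ^ leaves (\<tau> u)" by (intro power_mono) auto
      then show "exp (- 21 * real (leaves (\<tau> u))) \<le> (1 / 2696) ^ leaves (\<tau> u)"
        by (simp add: exp_minus power_divide field_simps flip: exp_of_nat_mult)
    qed (use sqerr_nonneg[of "sqrt_on J t" "\<tau> u" a L] in auto)
    finally show "exp (- (hdist J t u)\<^sup>2 / 8 - (?e u)\<^sup>2 / 4)
        \<le> (1 / 2696) ^ leaves (\<tau> u) * exp (- sqerr (sqrt_on J t) (\<tau> u) a L / 84)" .
  qed
  also have "\<dots> = (\<Sum>T\<in>\<tau> ` F. (1 / 2696) ^ leaves T * exp (- sqerr (sqrt_on J t) T a L / 84))"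
  proof -
    have "inj_on \<tau> F" using \<tau>(1) by (metis inj_onI)
    then show ?thesis by (simp add: sum.reindex)
  qed
  also have "\<dots> \<le> 1 / 2"
    using F(1) by (intro weighted_tree_sum_le square_integrable_sqrt_on t L) auto
  finally have "ennreal (\<Sum>u\<in>F. exp (- (hdist J t u)\<^sup>2 / 8 - (?e u)\<^sup>2 / 4)) \<le> ennreal 1"
    by (intro ennreal_leI) simp
  then show "(\<Sum>u\<in>F. ennreal (exp (- (hdist J t u)\<^sup>2 / 8 - (?e u)\<^sup>2 / 4))) \<le> 1" by simp
qed

end

section \<open>The adaptive estimator\<close>

context nondegenerate_interval
begin

text \<open>
  For \<open>p = 1/\<alpha>\<close> the \<open>p\<close>-variation is \<open>V\<^sup>p\<close>, and \<open>2 p / (p + 2) = 2 / (2 \<alpha> + 1)\<close>.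
\<close>

lemma ex_near_intensity:
  assumes s: "s \<in> L1plus J" and \<alpha>: "0 < \<alpha>" "\<alpha> \<le> 1" and V: "0 \<le> V"
    and var: "alpha_variation \<alpha> (\<lambda>x. sqrt (s x)) J = ennreal V"
  obtains T where "(hdist J s (intensity a L T))\<^sup>2 \<le> 2 * real (leaves T)"
    and "real (leaves T) \<le> 5 * max (sqrt L * V) 1 powr (2 / (2 * \<alpha> + 1))"
proof -
  define p where "p = 1 / \<alpha>"
  have p: "1 \<le> p" using \<alpha> by (simp add: p_def)
  let ?pv = "power_variation p (\<lambda>x. sqrt (s x)) J"
  define w where "w = enn2real ?pv"
  have fin: "?pv \<noteq> \<infinity>" using var by (auto simp: alpha_variation_def p_def split: if_splits)
  then have pv: "?pv = ennreal w" by (simp add: w_def less_top)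
  have w: "0 \<le> w" by (simp add: w_def)
  have "ennreal (w powr \<alpha>) = ennreal V" using var fin by (simp add: alpha_variation_def p_def w_def)
  then have "V = w powr \<alpha>" using V by simp
  then have wV: "w = V powr p" using \<alpha> w by (simp add: p_def powr_powr)
  have "power_variation p (sqrt_on J s) ({a..<a + L} \<inter> J) \<le> power_variation p (sqrt_on J s) J"
    by (rule power_variation_mono) simp
  also have "\<dots> = ?pv"
    using s by (intro power_variation_cong) (simp add: sqrt_on_def)
  finally have "power_variation p (sqrt_on J s) ({a..<a + L} \<inter> J) \<le> ennreal w" unfolding pv .
  moreover have "0 \<le> sqrt_on J s x" for x
    using s by (auto simp: sqrt_on_def L1plus_def indicator_def)
  ultimately obtain T where T: "sqerr (sqrt_on J s) T a L \<le> 4 * real (leaves T)"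
      "real (leaves T) \<le> leaf_bound p (L powr (p / 2) * w)"
    using ex_tree_approximation[OF square_integrable_sqrt_on[OF s] _ p L inner _ w] by blast
  let ?M = "max (sqrt L * V) 1"
  have "leaf_bound p (L powr (p / 2) * w) \<le> 5 * ?M powr (2 / (2 * \<alpha> + 1))"
  proof (cases "L powr (p / 2) * w \<le> 1")
    case True
    have "1 \<le> ?M powr (2 / (2 * \<alpha> + 1))" using \<alpha> by (intro ge_one_powr_ge_zero) auto
    then show ?thesis using True by (simp add: leaf_bound_def)
  next
    case False
    have "L powr (p / 2) * w = (sqrt L * V) powr p"
      using L by (simp add: wV powr_mult powr_powr flip: powr_half_sqrt)
    then have "(L powr (p / 2) * w) powr (2 / (p + 2)) = (sqrt L * V) powr (p * (2 / (p + 2)))"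
      by (simp add: powr_powr)
    also have "p * (2 / (p + 2)) = 2 / (2 * \<alpha> + 1)"
      using \<alpha> by (simp add: p_def field_simps)
    also have "(sqrt L * V) powr (2 / (2 * \<alpha> + 1)) \<le> ?M powr (2 / (2 * \<alpha> + 1))"
      using \<alpha> L V by (intro powr_mono2) auto
    finally show ?thesis using False by (simp add: leaf_bound_def)
  qed
  then show ?thesis
    using that[of T] T hdist_intensity[OF s, of T] by simp
qed

text \<open>
  Apply the risk bound at the adaptive approximation \<open>t\<close> of \<open>s\<close>. If it has \<open>N\<close> leaves, then
  \<open>H\<^sup>2(s, t) \<le> 2 N\<close> and \<open>\<eta>\<^sup>2(t) \<le> 84 N\<close>, so that \<open>r = \<surd>(336 N)\<close> satisfies both conditions.
\<close>

theorem ex_adaptive_T_estimator: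
  obtains est where "T_estimator J est"
    and "\<And>s \<alpha> V q C. \<lbrakk>s \<in> L1plus J; 0 < \<alpha>; \<alpha> \<le> 1; 0 \<le> V;
        alpha_variation \<alpha> (\<lambda>x. sqrt (s x)) J = ennreal V; 1 \<le> q; 0 \<le> C;
        \<And>x. 0 \<le> x \<Longrightarrow> x powr q \<le> C * exp (x\<^sup>2 / 16)\<rbrakk> \<Longrightarrow>
      (\<integral>\<^sup>+X. ennreal (hdist J s (est X) powr q) \<partial>poisson_process (mean_measure J s))
        \<le> ennreal (2 powr q * (2 * sqrt 1680 powr q + C) * max (sqrt L * V) 1 powr (q / (2 * \<alpha> + 1)))"
proof -
  define S where "S = range (intensity a L)"
  let ?e = "tree_penalty a L"
  let ?\<psi> = "ratio_test J ?e"
  have S: "countable S" "S \<subseteq> L1plus J"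
    unfolding S_def using countable_intensities intensity_L1plus by auto
  have \<psi>: "test_family J S ?e ?\<psi>"
    by (rule test_family_ratio_test[OF J_borel finite_measure_J S(2)])
  have ex: "\<exists>t\<in>S. \<forall>u\<in>S. T_criterion J S ?\<psi> X t \<le> T_criterion J S ?\<psi> X u" for X
  proof (rule ex_T_criterion_minimizer[OF J_borel S(2)])
    show "finite {t \<in> S. cost J ?e t \<le> K}" for K unfolding S_def by (rule finite_cost_sublevel)
    have zero: "intensity a L (Leaf 0) = (\<lambda>_. 0)" by (simp add: intensity_def fun_eq_iff)
    show "(\<lambda>_. 0) \<in> S" unfolding S_def zero[symmetric] by simp
    show "\<exists>u\<in>S. R < hdist J (\<lambda>_. 0) u" for R
    proof -
      obtain k :: nat where k: "\<bar>R\<bar> < real k" using reals_Archimedean2 by blast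
      let ?u = "intensity a L (Leaf (2 * k))"
      have z: "(\<lambda>_. 0) \<in> L1plus J" using zero intensity_L1plus[of "Leaf 0"] by simp
      have "sqrt_on J (\<lambda>_. 0) = (\<lambda>_. 0)" by (simp add: sqrt_on_def fun_eq_iff)
      then have "(hdist J (\<lambda>_. 0) ?u)\<^sup>2 = sqerr (\<lambda>_. 0) (Leaf (2 * k)) a L / 2"
        using hdist_intensity[OF z, of "Leaf (2 * k)"] by simp
      also have "sqerr (\<lambda>_. 0) (Leaf (2 * k)) a L = (\<integral>x. indicator {a..<a + L} x * ((2 * real k)\<^sup>2 / L) \<partial>lborel)"
        unfolding sqerr_def using L
        by (intro Bochner_Integration.integral_cong) (auto simp: indicator_def power_divide power_mult_distrib)
      also have "\<dots> = (2 * real k)\<^sup>2" using L by simp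
      finally have "(hdist J (\<lambda>_. 0) ?u)\<^sup>2 = (real k)\<^sup>2 + (real k)\<^sup>2"
        by (simp add: power_mult_distrib)
      moreover have "R\<^sup>2 < (real k)\<^sup>2"
        using power_strict_mono[OF k, of 2] by simp
      ultimately have "R\<^sup>2 < (hdist J (\<lambda>_. 0) ?u)\<^sup>2"
        using zero_le_power2[of "real k"] by linarith
      then have "R < hdist J (\<lambda>_. 0) ?u" using hdist_nonneg by (rule power2_less_imp_less)
      then show ?thesis unfolding S_def by blast
    qed
  qed
  obtain est where est: "est \<in> measurable (configs (leb_on J)) (count_space S)"
    and min: "\<And>X u. X \<in> space (configs (leb_on J)) \<Longrightarrow> u \<in> S \<Longrightarrow> T_criterion J S ?\<psi> X (est X) \<le> T_criterion J S ?\<psi> X u"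
    using ex_measurable_minimizer[OF S(1) \<psi> ex] by blast
  have estS: "est X \<in> S" if "X \<in> space (configs (leb_on J))" for X
    using measurable_space[OF est that] by simp
  have "T_estimator J est"
    unfolding T_estimator_def
    by (intro exI[of _ "{1..}"] exI[of _ "tree_model a L"] exI[of _ tree_eta] exI[of _ "\<lambda>N. 5 * real N"]
        exI[of _ 1] exI[of _ ?\<psi>]) (use model_family_trees \<psi> est min in \<open>simp only: UN_tree_model S_def, blast\<close>)
  moreover have "(\<integral>\<^sup>+X. ennreal (hdist J s (est X) powr q) \<partial>poisson_process (mean_measure J s))
        \<le> ennreal (2 powr q * (2 * sqrt 1680 powr q + C) * max (sqrt L * V) 1 powr (q / (2 * \<alpha> + 1)))"
    if s: "s \<in> L1plus J" and \<alpha>: "0 < \<alpha>" "\<alpha> \<le> 1" and V: "0 \<le> V"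
      and var: "alpha_variation \<alpha> (\<lambda>x. sqrt (s x)) J = ennreal V" and q: "1 \<le> q" and C: "0 \<le> C"
        "\<And>x. 0 \<le> x \<Longrightarrow> x powr q \<le> C * exp (x\<^sup>2 / 16)" for s \<alpha> V q C
  proof -
    let ?M = "max (sqrt L * V) 1"
    obtain T where T: "(hdist J s (intensity a L T))\<^sup>2 \<le> 2 * real (leaves T)"
        "real (leaves T) \<le> 5 * ?M powr (2 / (2 * \<alpha> + 1))"
      using ex_near_intensity[OF s \<alpha> V var] by blast
    define t where "t = intensity a L T"
    define r where "r = sqrt (336 * real (leaves T))"
    have t: "t \<in> S" by (simp add: S_def t_def)
    have "?e t \<in> {x. \<bar>x\<bar> \<le> sqrt (84 * real (leaves T))}"
      using tree_penalty_attained[of t a L] t unfolding S_def t_def by blast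
    moreover have "sqrt (336 * real (leaves T)) = 2 * sqrt (84 * real (leaves T))"
      using real_sqrt_mult[of 4 "84 * real (leaves T)"] by simp
    ultimately have r2: "2 * \<bar>?e t\<bar> \<le> r" by (simp add: r_def)
    have r1: "4 * hdist J s t \<le> r"
      unfolding r_def using T(1) by (intro real_le_rsqrt) (simp add: power_mult_distrib t_def)
    have "r \<le> sqrt (336 * (5 * ?M powr (2 / (2 * \<alpha> + 1))))"
      unfolding r_def using T(2) by (intro real_sqrt_le_mono mult_left_mono) auto
    also have "\<dots> = sqrt 1680 * sqrt (?M powr (2 / (2 * \<alpha> + 1)))"
      by (simp add: real_sqrt_mult[symmetric])
    also have "sqrt (?M powr (2 / (2 * \<alpha> + 1))) = ?M powr (1 / (2 * \<alpha> + 1))"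
    proof -
      have "sqrt (?M powr (2 / (2 * \<alpha> + 1))) = (?M powr (2 / (2 * \<alpha> + 1))) powr (1 / 2)"
        by (simp add: powr_half_sqrt)
      also have "\<dots> = ?M powr (2 / (2 * \<alpha> + 1) * (1 / 2))" by (rule powr_powr)
      also have "2 / (2 * \<alpha> + 1) * (1 / 2) = 1 / (2 * \<alpha> + 1)" using \<alpha> by (simp add: field_simps)
      finally show ?thesis .
    qed
    finally have "r powr q \<le> (sqrt 1680 * ?M powr (1 / (2 * \<alpha> + 1))) powr q"
      using q by (intro powr_mono2) (auto simp: r_def)
    then have rq: "r powr q \<le> sqrt 1680 powr q * ?M powr (q / (2 * \<alpha> + 1))"
      by (simp add: powr_mult powr_powr)
    have one: "1 \<le> ?M powr (q / (2 * \<alpha> + 1))" using \<alpha> q by (intro ge_one_powr_ge_zero) auto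
    have "(\<integral>\<^sup>+X. ennreal (hdist J s (est X) powr q) \<partial>poisson_process (mean_measure J s))
      \<le> ennreal (2 powr q) * (ennreal (2 * r powr q) + ennreal C *
        (\<integral>\<^sup>+u. ennreal (exp (- (hdist J t u)\<^sup>2 / 8 - (?e u)\<^sup>2 / 4)) \<partial>count_space S))"
      by (rule T_estimator_risk[where e = ?e and t = t and est = est, OF J_borel finite_measure_J S \<psi> _ _ s t r1 r2 q C]) (fact estS min)+
    also have "\<dots> \<le> ennreal (2 powr q) * (ennreal (2 * r powr q) + ennreal C * 1)"
      using tree_penalised_sum_le[of t] t S(2) unfolding S_def
      by (intro mult_left_mono add_left_mono) auto
    also have "\<dots> = ennreal (2 powr q * (2 * r powr q + C))"
      using C(1) by (simp flip: ennreal_plus ennreal_mult)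
    also have "\<dots> \<le> ennreal (2 powr q * (2 * sqrt 1680 powr q + C) * ?M powr (q / (2 * \<alpha> + 1)))"
    proof (rule ennreal_leI)
      have "2 * r powr q + C \<le> 2 * (sqrt 1680 powr q * ?M powr (q / (2 * \<alpha> + 1))) + C * ?M powr (q / (2 * \<alpha> + 1))"
        using rq one C(1) mult_left_mono[OF one C(1)] by linarith
      then have "2 powr q * (2 * r powr q + C) \<le> 2 powr q *
          (2 * (sqrt 1680 powr q * ?M powr (q / (2 * \<alpha> + 1))) + C * ?M powr (q / (2 * \<alpha> + 1)))"
        by (intro mult_left_mono) auto
      then show "2 powr q * (2 * r powr q + C) \<le> 2 powr q * (2 * sqrt 1680 powr q + C) * ?M powr (q / (2 * \<alpha> + 1))"
        by (simp add: algebra_simps)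
    qed
    finally show ?thesis .
  qed
  ultimately show ?thesis by (rule that)
qed

end

section \<open>Intervals of length zero\<close>

lemma hdist_zero_of_null:
  assumes J: "J \<in> sets borel" "emeasure lborel J = 0" and t: "t \<in> L1plus J" "u \<in> L1plus J"
  shows "hdist J t u = 0"
proof -
  have "(\<integral>x. (sqrt (t x) - sqrt (u x))\<^sup>2 \<partial>leb_on J) = (\<integral>x. 0 \<partial>leb_on J)"
  proof (rule integral_cong_AE)
    show "AE x in leb_on J. (sqrt (t x) - sqrt (u x))\<^sup>2 = 0"
      unfolding leb_on_def using J
      by (intro AE_I[of _ _ J]) (auto simp: emeasure_restrict_space space_restrict_space sets_restrict_space)
  qed (use t in \<open>auto simp: L1plus_def\<close>)
  then show ?thesis using hdist_eq[OF J(1) t] by simp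
qed

text \<open>
  On a null set the single candidate 0 suffices.
\<close>

lemma T_estimator_zero:
  assumes "J \<in> sets borel" "emeasure lborel J = 0"
  shows "T_estimator J (\<lambda>_ _. 0)"
proof -
  let ?z = "\<lambda>_::real. 0 :: real"
  have z: "?z \<in> L1plus J" by (simp add: L1plus_def)
  have "D_model (L1plus J) (hdist J) {?z} 3 (1 / 2) 1"
    unfolding D_model_def
  proof (intro conjI ballI allI impI)
    fix t and x :: real
    let ?A = "{u \<in> {?z}. hdist J t u < x * 3}"
    have "card ?A \<le> card {?z}" by (rule card_mono) auto
    then have "real (card ?A) \<le> 1" by simp
    also have "\<dots> \<le> 1 * exp (1 / 2 * x\<^sup>2)" by simp
    finally show "real (card ?A) \<le> 1 * exp (1 / 2 * x\<^sup>2)" .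
  qed (use z in auto)
  then have "model_family J {0} (\<lambda>_. {?z}) (\<lambda>_. 3) (\<lambda>_. 1 / 2) 1"
    by (simp add: model_family_def)
  moreover have "test_family J (\<Union>m\<in>{0::nat}. {?z}) (eta_of {0} (\<lambda>_. {?z}) (\<lambda>_. 3)) (\<lambda>_ _ _. ?z)"
    by (simp add: test_family_def)
  ultimately show ?thesis
    unfolding T_estimator_def
    by (intro exI[of _ "{0}"] exI[of _ "\<lambda>_. {?z}"] exI[of _ "\<lambda>_. 3"] exI[of _ "\<lambda>_. 1 / 2"] exI[of _ 1]
        exI[of _ "\<lambda>_ _ _. ?z"]) auto
qed

text \<open>
  An interval of length zero is treated separately: there all intensities have distance zero, and
  the cells of the trees would have length zero.
\<close>

lemma bounded_interval_cases:
  assumes "is_interval J" "bounded J"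
  obtains (degenerate) "J \<in> sets borel" "emeasure lborel J = 0"
    | (nondegenerate) a L where "nondegenerate_interval J a L" "measure lborel J = L"
proof (cases "\<exists>x\<in>J. \<exists>y\<in>J. x < y")
  case False
  then have "\<exists>x. J \<subseteq> {x}" by (metis (no_types, lifting) insertCI linorder_neqE_linordered_idom subsetI)
  then have "countable J" by (meson countable_finite finite.simps finite_subset)
  then show ?thesis
    using degenerate emeasure_lborel_countable by (metis borel_closed countable_imp_null_set_lborel null_setsD2 sets_lborel)
next
  case True
  then obtain x y where xy: "x \<in> J" "y \<in> J" "x < y" by blast
  define a where "a = Inf J"
  define b where "b = Sup J"
  have bdd: "bdd_above J" "bdd_below J" using assms(2) by (auto simp: bounded_imp_bdd_above bounded_imp_bdd_below)
  have outer: "J \<subseteq> {a..b}" unfolding a_def b_def using bdd by (auto intro: cInf_lower cSup_upper)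
  have "a \<le> x" "y \<le> b" using outer xy by auto
  then have ab: "a < b" using xy(3) by linarith
  have inner: "{a<..<b} \<subseteq> J"
  proof
    fix z assume z: "z \<in> {a<..<b}"
    obtain u where u: "u \<in> J" "u < z" using z xy(1) cInf_lessD[of J z] unfolding a_def by auto
    obtain v where v: "v \<in> J" "z < v" using z xy(1) less_cSupD[of J z] unfolding b_def by auto
    show "z \<in> J" using assms(1) u v unfolding is_interval_1 by (meson less_imp_le)
  qed
  interpret nondegenerate_interval J a "b - a"
    using ab inner outer by unfold_locales auto
  have "emeasure lborel J \<le> ennreal (b - a)"
    using emeasure_mono[OF outer, of lborel] ab by simp
  moreover have "ennreal (b - a) \<le> emeasure lborel J"
    using emeasure_mono[OF inner, of lborel] ab by simp
  ultimately have "measure lborel J = b - a" using ab by (simp add: measure_def antisym)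
  then show ?thesis using nondegenerate nondegenerate_interval_axioms by blast
qed

section \<open>The risk under bounded variation\<close>

theorem corollary3:
  shows "\<exists>C :: real \<Rightarrow> real. \<forall>(J :: real set) (L :: real).
           is_interval J \<and> bounded J \<and> L = measure lborel J \<longrightarrow>
           (\<exists>est. T_estimator J est \<and>
              (\<forall>s \<alpha> V q.
                 s \<in> L1plus J \<and> 0 < \<alpha> \<and> \<alpha> \<le> 1 \<and> 0 \<le> V \<and>
                 alpha_variation \<alpha> (\<lambda>x. sqrt (s x)) J = ennreal V \<and> 1 \<le> q \<longrightarrow>
                 (\<integral>\<^sup>+ X. ennreal (hdist J s (est X) powr q) \<partial>poisson_process (mean_measure J s))
                   \<le> ennreal (C q * (max (sqrt L * V) 1) powr (q / (2 * \<alpha> + 1)))))"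
proof -
  have "\<forall>q::real. \<exists>C. 1 \<le> q \<longrightarrow> 0 \<le> C \<and> (\<forall>x\<ge>0. x powr q \<le> C * exp (x\<^sup>2 / 16))"
    by (metis less_imp_le powr_le_exp_square)
  then obtain K :: "real \<Rightarrow> real" where K: "\<And>q. 1 \<le> q \<Longrightarrow> 0 \<le> K q"
      "\<And>q x. 1 \<le> q \<Longrightarrow> 0 \<le> x \<Longrightarrow> x powr q \<le> K q * exp (x\<^sup>2 / 16)"
    by metis
  show ?thesis
  proof (intro exI[of _ "\<lambda>q. 2 powr q * (2 * sqrt 1680 powr q + K q)"] allI impI)
    fix J :: "real set" and L :: real
    assume JL: "is_interval J \<and> bounded J \<and> L = measure lborel J"
    then have "is_interval J" "bounded J" by auto
    then show "\<exists>est. T_estimator J est \<and>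
              (\<forall>s \<alpha> V q.
                 s \<in> L1plus J \<and> 0 < \<alpha> \<and> \<alpha> \<le> 1 \<and> 0 \<le> V \<and>
                 alpha_variation \<alpha> (\<lambda>x. sqrt (s x)) J = ennreal V \<and> 1 \<le> q \<longrightarrow>
                 (\<integral>\<^sup>+ X. ennreal (hdist J s (est X) powr q) \<partial>poisson_process (mean_measure J s))
                   \<le> ennreal (2 powr q * (2 * sqrt 1680 powr q + K q) * (max (sqrt L * V) 1) powr (q / (2 * \<alpha> + 1))))"
    proof (cases rule: bounded_interval_cases)
      case degenerate
      have "(\<lambda>_. 0) \<in> L1plus J" by (simp add: L1plus_def)
      then show ?thesis
        using T_estimator_zero[OF degenerate] hdist_zero_of_null[OF degenerate]
        by (intro exI[of _ "\<lambda>_ _. 0"]) simp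
    next
      case (nondegenerate a L')
      then have L': "L' = L" using JL by simp
      interpret nondegenerate_interval J a L using nondegenerate(1) unfolding L' .
      obtain est where "T_estimator J est"
        and "\<And>s \<alpha> V q C. \<lbrakk>s \<in> L1plus J; 0 < \<alpha>; \<alpha> \<le> 1; 0 \<le> V;
          alpha_variation \<alpha> (\<lambda>x. sqrt (s x)) J = ennreal V; 1 \<le> q; 0 \<le> C;
          \<And>x. 0 \<le> x \<Longrightarrow> x powr q \<le> C * exp (x\<^sup>2 / 16)\<rbrakk> \<Longrightarrow>
        (\<integral>\<^sup>+X. ennreal (hdist J s (est X) powr q) \<partial>poisson_process (mean_measure J s))
          \<le> ennreal (2 powr q * (2 * sqrt 1680 powr q + C) * max (sqrt L * V) 1 powr (q / (2 * \<alpha> + 1)))"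
        by (rule ex_adaptive_T_estimator) blast
      then show ?thesis using K by (intro exI[of _ est]) blast
    qed
  qed
qed

end
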